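(* For $\phi_T\in Y'$ let $\phi$ denote the mild solution to $$\phi_t(t)=-A^*\phi(t)-F(t)^*\phi(t),\quad t\in(0,T),\qquad \phi(T)=\phi_T.$$ The following two assertions are equivalent: (1) There exist a Banach space $X$, a compact operator $G$ from $Y'$ to $X$, and a constant $C>0$ such that $$|\phi_T|_{Y'}\le C\big(|B(\cdot)^*\phi|_{L^{p'}(0,T;U')}+|G\phi_T|_X\big),\qquad\forall\,\phi_T\in Y'.$$ (2) There exist a finite codimensional subspace $\widetilde Y$ of $Y'$ and a constant $C>0$ such that $$|\phi_T|_{Y'}\le C\,|B(\cdot)^*\phi|_{L^{p'}(0,T;U')},\qquad\forall\,\phi_T\in\widetilde Y.$$
   Context: $T>0$; $Y$ and $U$ are reflexive (real) Banach spaces with dual spaces $Y'$, $U'$; $p\in(1,\infty]$; $p'=p/(p-1)$ if $p<\infty$ and $p'=1$ if $p=\infty$. $A:\mathcal D(A)\subseteq Y\to Y$ generates a $C_0$-semigroup on $Y$, $F(\cdot)\in L^\infty(0,T;\mathcal L(Y))$, $B(\cdot)\in L^\infty(0,T;\mathcal L(U;Y))$; $^*$ denotes adjoint operators. Compact operators are linear. Finite codimensional subspace: a linear subspace $Y_0$ of a Banach space $Z$ is called finite codimensional (in $Z$) if there are $m\ge 0$ and linearly independent $z_1,\dots,z_m\in Z\setminus Y_0$ such that $Y_0$ and $z_1,\dots,z_m$ together linearly span $Z$. *)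

theory Defs
  imports "HOL-Analysis.Analysis"
begin

type_synonym 'a dual = "'a \<Rightarrow>\<^sub>L real"

definition reflexive_space :: "'a::banach itself \<Rightarrow> bool" where
  "reflexive_space _ \<longleftrightarrow>
     (\<forall>\<xi> :: 'a dual dual. \<exists>y. \<forall>f. blinfun_apply \<xi> f = blinfun_apply f y)"

definition badj :: "('a::real_normed_vector \<Rightarrow>\<^sub>L 'b::real_normed_vector) \<Rightarrow> 'b dual \<Rightarrow> 'a dual" where
  "badj L f = f o\<^sub>L L"

(* An unbounded operator is a pair of a domain D and a map A, of which only the values on D
   matter.  The following two definitions give the domain and the values of its adjoint; the
   functional g below is unique when D is dense. *)

definition adj_dom :: "'a::real_normed_vector set \<Rightarrow> ('a \<Rightarrow> 'a) \<Rightarrow> 'a dual set" where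
  "adj_dom D A = {f. \<exists>g :: 'a dual. \<forall>y\<in>D. blinfun_apply f (A y) = blinfun_apply g y}"

definition adj_op :: "'a::real_normed_vector set \<Rightarrow> ('a \<Rightarrow> 'a) \<Rightarrow> 'a dual \<Rightarrow> 'a dual" where
  "adj_op D A f = (THE g. \<forall>y\<in>D. blinfun_apply f (A y) = blinfun_apply g y)"

(* Values at negative times are irrelevant. *)

definition C0_semigroup :: "(real \<Rightarrow> ('a::real_normed_vector \<Rightarrow>\<^sub>L 'a)) \<Rightarrow> bool" where
  "C0_semigroup S \<longleftrightarrow>
     S 0 = id_blinfun \<and>
     (\<forall>s\<ge>0. \<forall>t\<ge>0. S (s + t) = S s o\<^sub>L S t) \<and>
     (\<forall>y. ((\<lambda>t. blinfun_apply (S t) y) \<longlongrightarrow> y) (at_right 0))"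

definition generates ::
    "'a::real_normed_vector set \<Rightarrow> ('a \<Rightarrow> 'a) \<Rightarrow> (real \<Rightarrow> ('a \<Rightarrow>\<^sub>L 'a)) \<Rightarrow> bool" where
  "generates D A S \<longleftrightarrow>
     C0_semigroup S \<and>
     (\<forall>y z. y \<in> D \<and> A y = z \<longleftrightarrow>
        ((\<lambda>h. (1 / h) *\<^sub>R (blinfun_apply (S h) y - y)) \<longlongrightarrow> z) (at_right 0))"

(* The library's has_bochner_integral and Borel measurability are only adequate for separable
   spaces, so strong measurability and the Bochner integral are stated here for arbitrary normed
   spaces.  They are meant for complete measures M, for which strongly measurable functions are
   also Borel measurable. *)

definition strongly_measurable :: "'a measure \<Rightarrow> ('a \<Rightarrow> 'b::real_normed_vector) \<Rightarrow> bool" where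
  "strongly_measurable M f \<longleftrightarrow>
     (\<exists>s. (\<forall>i::nat. simple_function M (s i)) \<and> (AE x in M. (\<lambda>i. s i x) \<longlonglongrightarrow> f x))"

definition bochner_integral_is ::
    "'a measure \<Rightarrow> ('a \<Rightarrow> 'b::real_normed_vector) \<Rightarrow> 'b \<Rightarrow> bool" where
  "bochner_integral_is M f v \<longleftrightarrow>
     strongly_measurable M f \<and>
     (\<exists>s. (\<forall>i::nat. Bochner_Integration.simple_bochner_integrable M (s i)) \<and>
          (\<lambda>i. \<integral>\<^sup>+x. ennreal (norm (f x - s i x)) \<partial>M) \<longlonglongrightarrow> 0 \<and>
          (\<lambda>i. Bochner_Integration.simple_bochner_integral M (s i)) \<longlonglongrightarrow> v)"

definition L_infinity :: "'a measure \<Rightarrow> ('a \<Rightarrow> 'b::real_normed_vector) \<Rightarrow> bool" where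
  "L_infinity M f \<longleftrightarrow> strongly_measurable M f \<and> (\<exists>K. AE x in M. norm (f x) \<le> K)"

definition Lq_norm :: "'a measure \<Rightarrow> real \<Rightarrow> ('a \<Rightarrow> 'b::real_normed_vector) \<Rightarrow> real" where
  "Lq_norm M q f = (\<integral>x. norm (f x) powr q \<partial>M) powr (1 / q)"

definition conj_exponent :: "ereal \<Rightarrow> real" where
  "conj_exponent p = (if p = \<infinity> then 1 else real_of_ereal p / (real_of_ereal p - 1))"

(* Mild solution of the backward equation
     phi'(t) = - A phi(t) - P(t) phi(t)  on (0,T),   phi(T) = phiT,
   i.e. a continuous phi with
     phi(t) = S(T-t) phiT + integral from t to T of S(s-t) P(s) phi(s) ds,
   S being the semigroup generated by (D, A). *)

definition backward_mild_solution ::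
    "real \<Rightarrow> 'a::real_normed_vector set \<Rightarrow> ('a \<Rightarrow> 'a) \<Rightarrow> (real \<Rightarrow> 'a \<Rightarrow> 'a) \<Rightarrow> 'a \<Rightarrow> (real \<Rightarrow> 'a) \<Rightarrow> bool"
  where
  "backward_mild_solution T D A P \<phi>T \<phi> \<longleftrightarrow>
     continuous_on {0..T} \<phi> \<and>
     (\<exists>S. generates D A S \<and>
        (\<forall>t\<in>{0..T}.
           bochner_integral_is (lebesgue_on {t..T})
             (\<lambda>s. blinfun_apply (S (s - t)) (P s (\<phi> s)))
             (\<phi> t - blinfun_apply (S (T - t)) \<phi>T)))"

definition finite_codimensional :: "'a::real_vector set \<Rightarrow> bool" where
  "finite_codimensional Y0 \<longleftrightarrow>
     subspace Y0 \<and>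
     (\<exists>Z. finite Z \<and> independent Z \<and> Z \<inter> Y0 = {} \<and> span (Y0 \<union> Z) = UNIV)"

(* Real Banach spaces as structures on a carrier set, which makes it possible to quantify over
   them inside a formula (HOL cannot quantify over types there).  Used with carriers in 'x + real for an
   arbitrary type 'x: every Banach space whose points form a set of some HOL type is covered, and
   the summand real only ensures that nontrivial Banach spaces are available for small 'x too. *)

locale banach_space_on =
  fixes X :: "'x set" and zero :: 'x and add :: "'x \<Rightarrow> 'x \<Rightarrow> 'x"
    and smul :: "real \<Rightarrow> 'x \<Rightarrow> 'x" and nrm :: "'x \<Rightarrow> real"
  assumes zero_in: "zero \<in> X"
    and add_in: "x \<in> X \<Longrightarrow> y \<in> X \<Longrightarrow> add x y \<in> X"
    and smul_in: "x \<in> X \<Longrightarrow> smul a x \<in> X"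
    and add_assoc: "x \<in> X \<Longrightarrow> y \<in> X \<Longrightarrow> z \<in> X \<Longrightarrow> add (add x y) z = add x (add y z)"
    and add_commute: "x \<in> X \<Longrightarrow> y \<in> X \<Longrightarrow> add x y = add y x"
    and add_zero: "x \<in> X \<Longrightarrow> add x zero = x"
    and add_neg: "x \<in> X \<Longrightarrow> add x (smul (- 1) x) = zero"
    and smul_add_right: "x \<in> X \<Longrightarrow> y \<in> X \<Longrightarrow> smul a (add x y) = add (smul a x) (smul a y)"
    and smul_add_left: "x \<in> X \<Longrightarrow> smul (a + b) x = add (smul a x) (smul b x)"
    and smul_smul: "x \<in> X \<Longrightarrow> smul a (smul b x) = smul (a * b) x"
    and smul_one: "x \<in> X \<Longrightarrow> smul 1 x = x"
    and nrm_nonneg: "x \<in> X \<Longrightarrow> nrm x \<ge> 0"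
    and nrm_eq_0: "x \<in> X \<Longrightarrow> nrm x = 0 \<longleftrightarrow> x = zero"
    and nrm_smul: "x \<in> X \<Longrightarrow> nrm (smul a x) = \<bar>a\<bar> * nrm x"
    and nrm_triangle: "x \<in> X \<Longrightarrow> y \<in> X \<Longrightarrow> nrm (add x y) \<le> nrm x + nrm y"
    and complete: "(\<And>n::nat. \<sigma> n \<in> X) \<Longrightarrow>
        (\<And>e. e > 0 \<Longrightarrow> \<exists>N. \<forall>m\<ge>N. \<forall>n\<ge>N. nrm (add (\<sigma> m) (smul (- 1) (\<sigma> n))) < e) \<Longrightarrow>
        \<exists>x\<in>X. (\<lambda>n. nrm (add (\<sigma> n) (smul (- 1) x))) \<longlonglongrightarrow> 0"

definition compact_operator_into ::
    "'x set \<Rightarrow> ('x \<Rightarrow> 'x \<Rightarrow> 'x) \<Rightarrow> (real \<Rightarrow> 'x \<Rightarrow> 'x) \<Rightarrow> ('x \<Rightarrow> real)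
       \<Rightarrow> ('a::real_normed_vector \<Rightarrow> 'x) \<Rightarrow> bool" where
  "compact_operator_into X add smul nrm G \<longleftrightarrow>
     (\<forall>f. G f \<in> X) \<and>
     (\<forall>f g. G (f + g) = add (G f) (G g)) \<and>
     (\<forall>a f. G (a *\<^sub>R f) = smul a (G f)) \<and>
     (\<forall>f. bounded (range f) \<longrightarrow>
        (\<exists>x\<in>X. \<exists>r::nat \<Rightarrow> nat. strict_mono r \<and>
           (\<lambda>n. nrm (add (G (f (r n))) (smul (- 1) x))) \<longlonglongrightarrow> 0))"

end

theory Submission
  imports Defs
begin

text \<open>
  Write \<open>N \<phi>\<close> for the norm of the observation \<open>t \<mapsto> (B t)\<^sup>* (\<phi> t)\<close>. The equivalence is a
  statement about perturbing the estimate \<open>norm \<phi>T \<le> C * N \<phi>\<close> by something finite-dimensional.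

  A compact perturbation is removed by restriction: a compact operator \<open>G\<close> is arbitrarily small
  on finite codimensional subspaces (\<open>compact_operator_small_on_finite_codimensional\<close>), and where
  \<open>C * nrm (G \<phi>T) \<le> norm \<phi>T / 2\<close> the compact term is absorbed into the left-hand side.
  The subspace is the common kernel of Hahn-Banach functionals that belong to a finite net of the unit ball.

  Conversely, given the estimate on a finite codimensional subspace, a projection along the given
  subspace would be the operator sought, were the subspace closed. In general, the missing dimensions are added one by one
  (\<open>estimate_modulo_finitely_many_functionals\<close>): a direction in the closure of the
  part already reached costs only a worse constant, because the observation depends continuously on
  the final datum, and any other direction costs one continuous functional. Finitely many functionals
  form a finite-rank operator (\<open>ex_compact_operator_norm_sum\<close>), whose target is encoded as a
  set of reals.

  The continuous dependence rests on a Gronwall bound for mild solutions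
  (\<open>mild_solution_for_bound\<close>). To subtract solutions they must refer to one semigroup, which
  is guaranteed by the uniqueness of the semigroup generated by an operator
  (\<open>generates_unique\<close>). Uniqueness and linearity then make \<open>N \<phi>\<close> a continuous quasi-seminorm of
  the final datum, on the subspace of those data that admit a mild solution.
\<close>

section \<open>Finite codimensional subspaces\<close>

text \<open>
  A spanning complement of least cardinality is automatically independent and disjoint from the
  subspace, because each of its elements is indispensable.
\<close>

lemma finite_codimensionalI:
  fixes Y0 :: "'a::real_vector set"
  assumes "subspace Y0" "finite W" "span (Y0 \<union> W) = UNIV"
  shows "finite_codimensional Y0"
proof -
  obtain Z where fin: "finite Z" and sp: "span (Y0 \<union> Z) = UNIV"
    and least: "\<And>W. finite W \<Longrightarrow> span (Y0 \<union> W) = UNIV \<Longrightarrow> card Z \<le> card W"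
    using ex_has_least_nat[of "\<lambda>W. finite W \<and> span (Y0 \<union> W) = UNIV" W card] assms(2,3) by auto
  have irredundant: "z \<notin> span (Y0 \<union> (Z - {z}))" if "z \<in> Z" for z
  proof
    assume z: "z \<in> span (Y0 \<union> (Z - {z}))"
    have "insert z (Y0 \<union> (Z - {z})) = Y0 \<union> Z" using that by auto
    then have "span (Y0 \<union> (Z - {z})) = UNIV" using span_redundant[OF z] sp by simp
    then have "card Z \<le> card (Z - {z})" using fin by (intro least) auto
    then show False using that fin by (metis card_Diff1_less not_less)
  qed
  have "independent Z"
    unfolding dependent_def using irredundant span_mono[of "Z - {z}" "Y0 \<union> (Z - {z})" for z] by blast
  moreover have "Z \<inter> Y0 = {}" using irredundant span_base[of _ "Y0 \<union> (Z - {_})"] by blast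
  ultimately show ?thesis unfolding finite_codimensional_def using assms(1) fin sp by blast
qed

text \<open>
  Subtracting a suitable multiple of one vector \<open>y\<close> with \<open>l y \<noteq> 0\<close> moves any element of the
  subspace into the kernel, so adding \<open>y\<close> to the complement suffices.
\<close>

lemma finite_codimensional_kernel:
  fixes Y0 :: "'a::real_vector set" and l :: "'a \<Rightarrow> real"
  assumes "finite_codimensional Y0" "linear l"
  shows "finite_codimensional (Y0 \<inter> {x. l x = 0})"
proof (cases "\<exists>y\<in>Y0. l y \<noteq> 0")
  case False
  then have "Y0 \<inter> {x. l x = 0} = Y0" by auto
  then show ?thesis using assms(1) by simp
next
  case True
  then obtain y where y: "y \<in> Y0" "l y \<noteq> 0" by blast
  obtain Z where Y0: "subspace Y0" and Z: "finite Z" "span (Y0 \<union> Z) = UNIV"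
    using assms(1) unfolding finite_codimensional_def by blast
  let ?K = "Y0 \<inter> {x. l x = 0}"
  have "Y0 \<subseteq> span (?K \<union> insert y Z)"
  proof
    fix x assume x: "x \<in> Y0"
    let ?a = "l x / l y"
    have "x - ?a *\<^sub>R y \<in> ?K"
      using x y Y0 assms(2) by (simp add: subspace_diff subspace_scale linear_diff linear_scale)
    then have "(x - ?a *\<^sub>R y) + ?a *\<^sub>R y \<in> span (?K \<union> insert y Z)"
      by (intro span_add span_scale span_base) auto
    then show "x \<in> span (?K \<union> insert y Z)" by simp
  qed
  moreover have "Z \<subseteq> span (?K \<union> insert y Z)" by (auto intro: span_base)
  ultimately have "span (Y0 \<union> Z) \<subseteq> span (?K \<union> insert y Z)" by (intro span_minimal) auto
  then have sp: "span (?K \<union> insert y Z) = UNIV" using Z(2) by auto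
  have "subspace {x. l x = 0}"
    unfolding subspace_def using linear_0[OF assms(2)] linear_add[OF assms(2)] linear_scale[OF assms(2)] by simp
  then have "subspace ?K" using Y0 by (rule subspace_inter[rotated])
  then show ?thesis by (rule finite_codimensionalI[OF _ _ sp]) (simp add: Z(1))
qed

lemma finite_codimensional_common_kernel:
  fixes L :: "('a::real_vector \<Rightarrow> real) set"
  assumes "finite L" "\<And>l. l \<in> L \<Longrightarrow> linear l"
  shows "finite_codimensional {x. \<forall>l\<in>L. l x = 0}"
  using assms
proof (induction L)
  case empty
  show ?case by (rule finite_codimensionalI[of _ "{}"]) auto
next
  case (insert k L)
  have eq: "{x. \<forall>l\<in>insert k L. l x = 0} = {x. \<forall>l\<in>L. l x = 0} \<inter> {x. k x = 0}" by auto
  show ?case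
    unfolding eq using insert.IH insert.prems by (blast intro: finite_codimensional_kernel)
qed

section \<open>The Hahn-Banach theorem\<close>

text \<open>
  For positive scalars the inequality implies equality, by applying it to the inverse scalar; an
  infimum inherits the inequality directly.
\<close>

definition sublinear :: "('a::real_vector \<Rightarrow> real) \<Rightarrow> bool" where
  "sublinear q \<longleftrightarrow> (\<forall>x y. q (x + y) \<le> q x + q y) \<and> (\<forall>a>0. \<forall>x. q (a *\<^sub>R x) \<le> a * q x)"

lemma sublinear_add: "sublinear q \<Longrightarrow> q (x + y) \<le> q x + q y"
  by (simp add: sublinear_def)

lemma sublinear_scale:
  assumes "sublinear q" "a > 0"
  shows "q (a *\<^sub>R x) = a * q x"
proof (rule antisym)
  show "q (a *\<^sub>R x) \<le> a * q x" using assms by (simp add: sublinear_def)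
  have "q (inverse a *\<^sub>R (a *\<^sub>R x)) \<le> inverse a * q (a *\<^sub>R x)"
    using assms unfolding sublinear_def by (metis positive_imp_inverse_positive)
  then show "a * q x \<le> q (a *\<^sub>R x)" using assms(2) by (simp add: field_simps)
qed

lemma sublinear_zero: "sublinear q \<Longrightarrow> q 0 = 0"
  using sublinear_scale[of q 2 0] by simp

lemma sublinear_minus: "sublinear q \<Longrightarrow> - q (- x) \<le> q x"
  using sublinear_add[of q x "- x"] sublinear_zero[of q] by simp

text \<open>
  The infimum below is the directional modification that makes the functional as small as possible at
  \<open>- z\<close>. A functional that cannot be decreased in this way is odd, hence linear; applied once
  to a given functional, the same modification forces every linear minorant to agree with it at
  \<open>z\<close>.
\<close>

lemma sublinear_decrease:
  assumes q: "sublinear q"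
  obtains q' where "sublinear q'" "q' \<le> q" "q' (- z) \<le> - q z"
proof -
  define g where "g x t = q (x + t *\<^sub>R z) - t * q z" for x t
  define q' where "q' x = (INF t\<in>{0..}. g x t)" for x
  have scale: "q (t *\<^sub>R z) = t * q z" if "t \<ge> 0" for t
    using that sublinear_scale[OF q] sublinear_zero[OF q] by (cases "t = 0") auto
  have bdd: "bdd_below (g x ` {0..})" for x
  proof (rule bdd_belowI2)
    fix t :: real assume "t \<in> {0..}"
    then have "t * q z = q ((x + t *\<^sub>R z) + (- x))" by (simp add: scale)
    also have "\<dots> \<le> q (x + t *\<^sub>R z) + q (- x)" by (rule sublinear_add[OF q])
    finally show "- q (- x) \<le> g x t" by (simp add: g_def)
  qed
  have le: "q' x \<le> g x t" if "t \<ge> 0" for x t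
    unfolding q'_def using that bdd by (intro cINF_lower) auto
  have ge: "c \<le> q' x" if "\<And>t. t \<ge> 0 \<Longrightarrow> c \<le> g x t" for c x
    unfolding q'_def using that by (intro cINF_greatest) auto
  have "sublinear q'"
    unfolding sublinear_def
  proof (intro conjI allI impI)
    fix x y
    have "q' (x + y) \<le> g x s + g y t" if "s \<ge> 0" "t \<ge> 0" for s t
    proof -
      have "q' (x + y) \<le> g (x + y) (s + t)" using that by (intro le) auto
      also have "\<dots> = q ((x + s *\<^sub>R z) + (y + t *\<^sub>R z)) - (s + t) * q z"
        by (simp add: g_def algebra_simps)
      also have "\<dots> \<le> g x s + g y t"
        using sublinear_add[OF q, of "x + s *\<^sub>R z" "y + t *\<^sub>R z"] by (simp add: g_def algebra_simps)
      finally show ?thesis .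
    qed
    then have "q' (x + y) - g x s \<le> q' y" if "s \<ge> 0" for s
      using that by (intro ge) (simp add: algebra_simps)
    then have "q' (x + y) - q' y \<le> q' x" by (intro ge) (simp add: algebra_simps)
    then show "q' (x + y) \<le> q' x + q' y" by simp
  next
    fix a :: real and x assume a: "a > 0"
    have "q' (a *\<^sub>R x) / a \<le> g x t" if "t \<ge> 0" for t
    proof -
      have "q' (a *\<^sub>R x) \<le> g (a *\<^sub>R x) (a * t)" using that a by (intro le) auto
      also have "\<dots> = q (a *\<^sub>R (x + t *\<^sub>R z)) - a * t * q z" by (simp add: g_def algebra_simps)
      also have "\<dots> = a * g x t" unfolding sublinear_scale[OF q a] by (simp add: g_def algebra_simps)
      finally show ?thesis using a by (simp add: field_simps)
    qed
    then have "q' (a *\<^sub>R x) / a \<le> q' x" by (rule ge)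
    then show "q' (a *\<^sub>R x) \<le> a * q' x" using a by (simp add: field_simps)
  qed
  moreover have "q' x \<le> q x" for x using le[of 0 x] by (simp add: g_def)
  then have "q' \<le> q" by (rule le_funI)
  moreover have "q' (- z) \<le> - q z"
    using le[of 1 "- z"] sublinear_zero[OF q] by (simp add: g_def)
  ultimately show ?thesis by (rule that)
qed

text \<open>
  Zorn's lemma yields a minimal sublinear minorant, and minimality against the decreased
  functionals makes it odd.
\<close>

lemma ex_linear_below_sublinear:
  assumes p: "sublinear p"
  obtains l where "linear l" "l \<le> p"
proof -
  let ?A = "{q. sublinear q \<and> q \<le> p}" and ?P = "\<lambda>q r :: 'a \<Rightarrow> real. r \<le> q"
  have "\<exists>m\<in>?A. \<forall>q\<in>?A. ?P m q \<longrightarrow> q = m"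
  proof (rule predicate_Zorn)
    show "partial_order_on ?A (relation_of ?P ?A)"
      by (rule partial_order_on_relation_ofI) auto
  next
    fix C assume C: "C \<in> Chains (relation_of ?P ?A)"
    have CA: "q \<in> ?A" if "q \<in> C" for q
      using C that unfolding Chains_def relation_of_def by blast
    have total: "q \<le> r \<or> r \<le> q" if "q \<in> C" "r \<in> C" for q r
      using C that unfolding Chains_def relation_of_def by blast
    show "\<exists>u\<in>?A. \<forall>q\<in>C. u \<le> q"
    proof (cases "C = {}")
      case True
      then show ?thesis using p by auto
    next
      case False
      define u where "u x = (INF q\<in>C. q x)" for x
      have bdd: "bdd_below ((\<lambda>q. q x) ` C)" for x
      proof (rule bdd_belowI2)
        fix q assume "q \<in> C"
        then have q: "sublinear q" "q \<le> p" using CA by auto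
        have "- p (- x) \<le> - q (- x)" using q(2) by (simp add: le_fun_def)
        also have "\<dots> \<le> q x" by (rule sublinear_minus[OF q(1)])
        finally show "- p (- x) \<le> q x" .
      qed
      have le: "u x \<le> q x" if "q \<in> C" for q x
        unfolding u_def using that bdd by (intro cINF_lower)
      have ge: "c \<le> u x" if "\<And>q. q \<in> C \<Longrightarrow> c \<le> q x" for c x
        unfolding u_def using that False by (intro cINF_greatest)
      have "sublinear u"
        unfolding sublinear_def
      proof (intro conjI allI impI)
        fix x y
        have u_le: "u (x + y) \<le> q x + r y" if qr: "q \<in> C" "r \<in> C" for q r
        proof -
          obtain s where s: "s \<in> C" "s \<le> q" "s \<le> r" using total[OF qr] qr by auto
          have "u (x + y) \<le> s (x + y)" by (rule le[OF s(1)])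
          also have "\<dots> \<le> s x + s y" using CA[OF s(1)] by (auto intro: sublinear_add)
          also have "\<dots> \<le> q x + r y" using s(2,3) by (auto simp: le_fun_def intro: add_mono)
          finally show ?thesis .
        qed
        have "u (x + y) - q x \<le> u y" if "q \<in> C" for q
          by (intro ge) (use u_le[OF that] in \<open>simp add: diff_le_eq add.commute\<close>)
        then have "u (x + y) - u y \<le> u x" by (intro ge) (simp add: algebra_simps)
        then show "u (x + y) \<le> u x + u y" by simp
      next
        fix a :: real and x assume a: "a > 0"
        have "u (a *\<^sub>R x) / a \<le> q x" if "q \<in> C" for q
          using le[OF that, of "a *\<^sub>R x"] sublinear_scale[of q a x] CA[OF that] a
          by (simp add: field_simps)
        then have "u (a *\<^sub>R x) / a \<le> u x" by (rule ge)
        then show "u (a *\<^sub>R x) \<le> a * u x" using a by (simp add: field_simps)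
      qed
      moreover have "u \<le> q" if "q \<in> C" for q using le[OF that] by (rule le_funI)
      moreover from this have "u \<le> p" using False CA order_trans by blast
      ultimately show ?thesis by blast
    qed
  qed
  then obtain m where m: "sublinear m" "m \<le> p"
    and minimal: "\<And>q. sublinear q \<Longrightarrow> q \<le> p \<Longrightarrow> q \<le> m \<Longrightarrow> q = m" by blast
  have odd: "m (- x) = - m x" for x
  proof -
    obtain q where q: "sublinear q" "q \<le> m" "q (- x) \<le> - m x"
      using sublinear_decrease[OF m(1)] by metis
    then have "q = m" using m(2) minimal order_trans by blast
    then show ?thesis using q(3) sublinear_minus[OF m(1), of "- x"] by simp
  qed
  have "linear m"
  proof (rule linearI)
    show "m (x + y) = m x + m y" for x y
      using sublinear_add[OF m(1), of x y] sublinear_add[OF m(1), of "- x" "- y"] odd[of "x + y"]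
      by (simp add: odd)
    show "m (a *\<^sub>R x) = a *\<^sub>R m x" for a x
    proof -
      consider "a > 0" | "a = 0" | "a < 0" by linarith
      then show ?thesis
      proof cases
        case 3
        then show ?thesis using sublinear_scale[OF m(1), of "- a" x] odd[of "a *\<^sub>R x"] by simp
      qed (auto simp: sublinear_scale[OF m(1)] sublinear_zero[OF m(1)])
    qed
  qed
  then show ?thesis using m(2) that by blast
qed

theorem Hahn_Banach_sublinear:
  assumes p: "sublinear p"
  obtains l where "linear l" "\<And>x. l x \<le> p x" "l z = p z"
proof -
  obtain q where q: "sublinear q" "q \<le> p" "q (- z) \<le> - p z"
    using sublinear_decrease[OF p] by metis
  obtain l where l: "linear l" "l \<le> q" using ex_linear_below_sublinear[OF q(1)] by metis
  have le: "l x \<le> p x" for x using l(2) q(2) by (meson le_fun_def order_trans)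
  have "- l z \<le> q (- z)" using l(2) linear_neg[OF l(1), of z] by (metis le_fun_def)
  then have "l z = p z" using q(3) le[of z] by simp
  with l(1) le show ?thesis by (rule that)
qed

section \<open>Compact operators are small on finite codimensional subspaces\<close>

text \<open>
  Compactness gives a finite \<open>e / 2\<close>-net \<open>K\<close> of the unit ball for the seminorm
  \<open>p\<close>. For every \<open>k\<close> in the net choose a linear functional below \<open>p\<close>
  that attains \<open>p\<close> at \<open>k\<close>. If all of these functionals vanish at a unit vector
  \<open>x\<close> and \<open>k\<close> is a net point near \<open>x\<close>, then \<open>p k = l k (k - x) < e / 2\<close>,
  so \<open>p x < e\<close>.
\<close>

lemma seminorm_small_on_finite_codimensional:
  fixes p :: "'v::real_normed_vector \<Rightarrow> real"
  assumes add: "\<And>x y. p (x + y) \<le> p x + p y"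
    and scale: "\<And>a x. p (a *\<^sub>R x) = \<bar>a\<bar> * p x"
    and cpt: "\<And>f. bounded (range f) \<Longrightarrow>
        \<exists>r::nat \<Rightarrow> nat. strict_mono r \<and> (\<forall>e>0. \<exists>N. \<forall>m\<ge>N. \<forall>n\<ge>N. p (f (r m) - f (r n)) < e)"
    and e: "e > 0"
  obtains Y where "finite_codimensional Y" "\<And>x. x \<in> Y \<Longrightarrow> p x \<le> e * norm x"
proof -
  have sub: "sublinear p" unfolding sublinear_def using add scale by auto
  have net: "\<exists>K. finite K \<and> (\<forall>x. norm x \<le> 1 \<longrightarrow> (\<exists>k\<in>K. p (x - k) < e / 2))"
  proof (rule ccontr)
    assume "\<not> ?thesis"
    then have "\<forall>K. \<exists>x. finite K \<longrightarrow> norm x \<le> 1 \<and> (\<forall>k\<in>K. e / 2 \<le> p (x - k))" by (meson not_less)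
    then obtain c where c: "\<And>K. finite K \<Longrightarrow> norm (c K) \<le> 1"
      "\<And>K k. finite K \<Longrightarrow> k \<in> K \<Longrightarrow> e / 2 \<le> p (c K - k)" by metis
    \<comment> \<open>without a finite net, a sequence of pairwise distant points arises by choosing each point far from the set of its predecessors\<close>
    define S where "S = rec_nat {} (\<lambda>_ K. insert (c K) K)"
    have S: "S 0 = {}" "S (Suc n) = insert (c (S n)) (S n)" for n by (auto simp: S_def)
    have fin: "finite (S n)" for n by (induction n) (auto simp: S)
    have "incseq S" by (rule incseq_SucI) (auto simp: S)
    then have mem: "c (S m) \<in> S n" if "m < n" for m n
      using incseqD[OF \<open>incseq S\<close> Suc_leI[OF that]] S(2)[of m] by auto
    have "bounded (range (\<lambda>n. c (S n)))"
      unfolding bounded_iff using c(1)[OF fin] by auto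
    then obtain r :: "nat \<Rightarrow> nat" where r: "strict_mono r"
      "\<forall>e>0. \<exists>N. \<forall>m\<ge>N. \<forall>n\<ge>N. p (c (S (r m)) - c (S (r n))) < e" using cpt by blast
    then obtain N where "\<forall>m\<ge>N. \<forall>n\<ge>N. p (c (S (r m)) - c (S (r n))) < e / 2"
      using e by (meson half_gt_zero)
    then have "p (c (S (r (Suc N))) - c (S (r N))) < e / 2" by simp
    moreover have "c (S (r N)) \<in> S (r (Suc N))" using r(1) by (intro mem) (simp add: strict_mono_def)
    ultimately show False using c(2)[OF fin] by (meson not_less)
  qed
  then obtain K where K: "finite K" "\<And>x. norm x \<le> 1 \<Longrightarrow> \<exists>k\<in>K. p (x - k) < e / 2" by blast
  have "\<forall>k. \<exists>l. linear l \<and> (\<forall>x. l x \<le> p x) \<and> l k = p k"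
    using Hahn_Banach_sublinear[OF sub] by metis
  then obtain l where l: "\<And>k. linear (l k)" "\<And>k x. l k x \<le> p x" "\<And>k. l k k = p k" by metis
  define Y where "Y = {x. \<forall>g\<in>l ` K. g x = 0}"
  have "finite_codimensional Y"
    unfolding Y_def using K(1) l(1) by (intro finite_codimensional_common_kernel) auto
  moreover have "p x \<le> e * norm x" if x: "x \<in> Y" for x
  proof (cases "x = 0")
    case True
    then show ?thesis using sublinear_zero[OF sub] by simp
  next
    case False
    define y where "y = inverse (norm x) *\<^sub>R x"
    have "norm y \<le> 1" using False by (simp add: y_def)
    then obtain k where k: "k \<in> K" "p (y - k) < e / 2" using K(2) by blast
    have "l k y = 0" using x k(1) l(1)[of k] by (simp add: Y_def y_def linear_scale)
    then have "p k = l k (k - y)" using l(1)[of k] l(3)[of k] by (simp add: linear_diff)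
    also have "\<dots> \<le> p (k - y)" by (rule l(2))
    also have "\<dots> = p (y - k)" using scale[of "- 1" "y - k"] by simp
    finally have "p k < e / 2" using k(2) by simp
    then have "p y < e" using add[of "y - k" k] k(2) by simp
    moreover have "p y = p x / norm x" using scale by (simp add: y_def divide_inverse mult.commute)
    ultimately show ?thesis using False by (simp add: field_simps)
  qed
  ultimately show ?thesis by (rule that)
qed

text \<open>
  A sequence whose images converge in the carrier is Cauchy for the seminorm \<open>nrm \<circ> G\<close>,
  so the preceding lemma applies without any topology on the carrier.
\<close>

lemma (in banach_space_on) compact_operator_small_on_finite_codimensional:
  fixes G :: "'v::real_normed_vector \<Rightarrow> 'x"
  assumes G: "compact_operator_into X add smul nrm G" and e: "e > 0"
  obtains Y where "finite_codimensional Y" "\<And>x. x \<in> Y \<Longrightarrow> nrm (G x) \<le> e * norm x"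
proof -
  have GX: "G f \<in> X" and Gadd: "G (f + g) = add (G f) (G g)" and Gscale: "G (a *\<^sub>R f) = smul a (G f)"
    for f g a using G by (auto simp: compact_operator_into_def)
  have Gdiff: "G (f - g) = add (G f) (smul (- 1) (G g))" for f g
    using Gadd[of f "- g"] Gscale[of "- 1" g] by simp
  have cancel: "nrm (add a (smul (- 1) b)) \<le> nrm (add a (smul (- 1) x)) + nrm (add b (smul (- 1) x))"
    if "a \<in> X" "b \<in> X" "x \<in> X" for a b x
  proof -
    let ?m = "smul (- 1)"
    have in_X: "?m a \<in> X" "?m b \<in> X" "?m x \<in> X" using that smul_in by auto
    have "add (add a (?m x)) (add x (?m b)) = add a (add (?m x) (add x (?m b)))"
      using that in_X add_in by (simp add: add_assoc)
    also have "add (?m x) (add x (?m b)) = add (add x (?m x)) (?m b)"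
      using that in_X add_commute[of x "?m x"] by (simp add: add_assoc)
    also have "\<dots> = add (?m b) zero" using that in_X add_neg zero_in add_commute by simp
    also have "\<dots> = ?m b" by (rule add_zero[OF in_X(2)])
    finally have eq: "add a (?m b) = add (add a (?m x)) (add x (?m b))" by simp
    have "?m (add b (?m x)) = add (?m b) x"
      using that in_X by (simp add: smul_add_right smul_smul smul_one)
    then have "add x (?m b) = ?m (add b (?m x))" using that in_X add_commute by simp
    then have "nrm (add x (?m b)) = nrm (add b (?m x))"
      using nrm_smul[of "add b (?m x)" "- 1"] that in_X add_in by simp
    then show ?thesis
      unfolding eq using nrm_triangle[of "add a (?m x)" "add x (?m b)"] that in_X add_in by simp
  qed
  show ?thesis
  proof (rule seminorm_small_on_finite_codimensional[of "\<lambda>x. nrm (G x)" e])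
    show "nrm (G (x + y)) \<le> nrm (G x) + nrm (G y)" for x y using nrm_triangle GX Gadd by simp
    show "nrm (G (a *\<^sub>R x)) = \<bar>a\<bar> * nrm (G x)" for a x using nrm_smul GX Gscale by simp
    show "\<exists>r::nat \<Rightarrow> nat. strict_mono r \<and>
      (\<forall>e>0. \<exists>N. \<forall>m\<ge>N. \<forall>n\<ge>N. nrm (G (f (r m) - f (r n))) < e)"
      if "bounded (range f)" for f
    proof -
      obtain x r where x: "x \<in> X" and r: "strict_mono (r :: nat \<Rightarrow> nat)"
        and lim: "(\<lambda>n. nrm (add (G (f (r n))) (smul (- 1) x))) \<longlonglongrightarrow> 0"
        using G \<open>bounded (range f)\<close> unfolding compact_operator_into_def by blast
      have "\<exists>N. \<forall>m\<ge>N. \<forall>n\<ge>N. nrm (G (f (r m) - f (r n))) < e" if "e > 0" for e :: real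
      proof -
        obtain N where N: "\<And>n. n \<ge> N \<Longrightarrow> \<bar>nrm (add (G (f (r n))) (smul (- 1) x))\<bar> < e / 2"
          using LIMSEQ_D[OF lim, of "e / 2"] \<open>e > 0\<close> by auto
        have "nrm (G (f (r m) - f (r n))) < e" if "m \<ge> N" "n \<ge> N" for m n
          unfolding Gdiff
          using cancel[OF GX GX x, of "f (r m)" "f (r n)"] N[OF that(1)] N[OF that(2)] by linarith
        then show ?thesis by blast
      qed
      then show ?thesis using r by blast
    qed
  qed (use e that in auto)
qed

section \<open>Extending an estimate from a finite codimensional subspace\<close>

text \<open>
  The distance to a subspace is the seminorm of the quotient; a Hahn-Banach functional below it
  is continuous and vanishes on the subspace.
\<close>

lemma sublinear_infdist_subspace:
  fixes H :: "'v::real_normed_vector set"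
  assumes H: "subspace H"
  shows "sublinear (\<lambda>x. infdist x H)"
proof -
  have ne: "H \<noteq> {}" using subspace_0[OF H] by auto
  have near: "\<exists>h\<in>H. norm (x - h) < infdist x H + e" if "e > 0" for x and e :: real
  proof (rule ccontr)
    assume "\<not> ?thesis"
    then have "infdist x H + e \<le> infdist x H"
      unfolding infdist_notempty[OF ne, of x] using ne by (intro cINF_greatest) (auto simp: dist_norm)
    then show False using that by simp
  qed
  show ?thesis
    unfolding sublinear_def
  proof (intro conjI allI impI)
    fix x y
    show "infdist (x + y) H \<le> infdist x H + infdist y H"
    proof (rule field_le_epsilon)
      fix e :: real assume "e > 0"
      then obtain h k where h: "h \<in> H" "norm (x - h) < infdist x H + e / 2"
        and k: "k \<in> H" "norm (y - k) < infdist y H + e / 2" using near half_gt_zero by metis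
      have "infdist (x + y) H \<le> dist (x + y) (h + k)"
        using h(1) k(1) H by (intro infdist_le) (simp add: subspace_add)
      also have "\<dots> \<le> norm (x - h) + norm (y - k)" by (simp add: dist_norm norm_diff_triangle_ineq)
      finally show "infdist (x + y) H \<le> infdist x H + infdist y H + e" using h(2) k(2) by simp
    qed
  next
    fix a :: real and x assume a: "a > 0"
    have "infdist (a *\<^sub>R x) H / a \<le> infdist x H"
    proof (rule field_le_epsilon)
      fix e :: real assume "e > 0"
      then obtain h where h: "h \<in> H" "norm (x - h) < infdist x H + e" using near by blast
      have "infdist (a *\<^sub>R x) H \<le> dist (a *\<^sub>R x) (a *\<^sub>R h)"
        using h(1) H by (intro infdist_le) (simp add: subspace_scale)
      also have "\<dots> = a * norm (x - h)" using a by (simp add: dist_norm flip: scaleR_diff_right)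
      finally have "infdist (a *\<^sub>R x) H / a \<le> norm (x - h)" using a by (simp add: field_simps)
      then show "infdist (a *\<^sub>R x) H / a \<le> infdist x H + e" using h(2) by simp
    qed
    then show "infdist (a *\<^sub>R x) H \<le> a * infdist x H" using a by (simp add: field_simps)
  qed
qed

lemma separating_functional:
  fixes H :: "'v::real_normed_vector set"
  assumes H: "subspace H" and w: "w \<notin> closure H"
  obtains l :: "'v dual" where "l w = 1" "\<And>h. h \<in> H \<Longrightarrow> l h = 0"
proof -
  let ?d = "infdist w H"
  have ne: "H \<noteq> {}" using subspace_0[OF H] by auto
  have d: "?d > 0"
    using w in_closure_iff_infdist_zero[OF ne, of w] infdist_nonneg[of w H] by simp
  obtain l where l: "linear l" "\<And>x. l x \<le> infdist x H" "l w = ?d"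
    using Hahn_Banach_sublinear[OF sublinear_infdist_subspace[OF H]] by metis
  have bound: "\<bar>l x\<bar> \<le> norm x" for x
  proof -
    have "infdist y H \<le> norm y" for y using infdist_le[OF subspace_0[OF H], of y] by simp
    then have "l x \<le> norm x" "l (- x) \<le> norm x"
      using l(2) order_trans norm_minus_cancel by metis+
    then show ?thesis using linear_neg[OF l(1), of x] by linarith
  qed
  have "bounded_linear (\<lambda>x. l x / ?d)"
  proof (rule bounded_linear_intro)
    show "l (x + y) / ?d = l x / ?d + l y / ?d" for x y
      using l(1) by (simp add: linear_add add_divide_distrib)
    show "l (a *\<^sub>R x) / ?d = a *\<^sub>R (l x / ?d)" for a x using l(1) by (simp add: linear_scale)
    show "norm (l x / ?d) \<le> norm x * (1 / ?d)" for x using bound[of x] d by (simp add: field_simps)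
  qed
  then have ap: "blinfun_apply (Blinfun (\<lambda>x. l x / ?d)) = (\<lambda>x. l x / ?d)"
    by (rule bounded_linear_Blinfun_apply)
  have "l h = 0" if h: "h \<in> H" for h
  proof -
    have "infdist h H = 0" "infdist (- h) H = 0" using h H by (auto intro: infdist_zero subspace_neg)
    then show ?thesis using l(2)[of h] l(2)[of "- h"] linear_neg[OF l(1), of h] by simp
  qed
  then show ?thesis using that[of "Blinfun (\<lambda>x. l x / ?d)"] ap l(3) d by simp
qed

text \<open>
  One more dimension spanned by \<open>w\<close> can be added for one of two reasons. If \<open>w\<close>
  is in the closure of \<open>H\<close>, the estimate extends by continuity of \<open>n\<close>. Otherwise a
  continuous functional that vanishes on \<open>H\<close> and is \<open>1\<close> at \<open>w\<close> recovers the
  coefficient of \<open>w\<close>, and its value is added to the right-hand side. The distinction is needed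
  since a finite codimensional subspace need not be closed, so that the coordinate along \<open>w\<close>
  may be discontinuous. The factor \<open>2\<close> in the triangle inequality leaves room for
  quasi-seminorms.
\<close>

lemma estimate_add_dimension:
  fixes n :: "'v::real_normed_vector \<Rightarrow> real"
  assumes E: "subspace E"
    and n0: "\<And>x. x \<in> E \<Longrightarrow> 0 \<le> n x"
    and nM: "\<And>x. x \<in> E \<Longrightarrow> n x \<le> M * norm x"
    and nadd: "\<And>x y. x \<in> E \<Longrightarrow> y \<in> E \<Longrightarrow> n (x + y) \<le> 2 * (n x + n y)"
    and H: "subspace H" "H \<subseteq> E" and w: "w \<in> E"
    and \<Phi>: "finite \<Phi>" and C: "C > 0"
    and est: "\<And>x. x \<in> H \<Longrightarrow> norm x \<le> C * (n x + (\<Sum>l\<in>\<Phi>. \<bar>blinfun_apply l x\<bar>))"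
  obtains \<Psi> C' where "finite \<Psi>" "C' > 0"
    "\<And>h a. h \<in> H \<Longrightarrow> norm (h + a *\<^sub>R w) \<le> C' * (n (h + a *\<^sub>R w) + (\<Sum>l\<in>\<Psi>. \<bar>blinfun_apply l (h + a *\<^sub>R w)\<bar>))"
proof (cases "w \<in> closure H")
  case True
  have "norm x \<le> 2 * C * (n x + (\<Sum>l\<in>\<Phi>. \<bar>blinfun_apply l x\<bar>))" if "x = h + a *\<^sub>R w" "h \<in> H" for x h a
  proof -
    have xE: "x \<in> E" using that w H(2) E by (auto intro: subspace_add subspace_scale)
    \<comment> \<open>approximate the direction w within H; then h + a t j lies in H and tends to x\<close>
    obtain t where t: "\<And>j. t j \<in> H" "t \<longlonglongrightarrow> w" using True unfolding closure_sequential by blast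
    define s where "s j = h + a *\<^sub>R t j" for j
    have s: "\<And>j. s j \<in> H" "s \<longlonglongrightarrow> x"
      unfolding s_def that(1) using t H(1) that(2)
      by (auto intro!: subspace_add subspace_scale tendsto_intros)
    have ineq: "norm (s j) \<le> C * (2 * (n x + M * norm (s j - x)) + (\<Sum>l\<in>\<Phi>. \<bar>blinfun_apply l (s j)\<bar>))" for j
    proof -
      have sE: "s j \<in> E" "s j - x \<in> E" using s(1) H(2) xE E by (auto intro: subspace_diff)
      have "n (x + (s j - x)) \<le> 2 * (n x + n (s j - x))" using xE sE by (intro nadd)
      then have "n (s j) \<le> 2 * (n x + M * norm (s j - x))" using nM[OF sE(2)] by simp
      then have "C * (n (s j) + (\<Sum>l\<in>\<Phi>. \<bar>blinfun_apply l (s j)\<bar>)) \<le>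
          C * (2 * (n x + M * norm (s j - x)) + (\<Sum>l\<in>\<Phi>. \<bar>blinfun_apply l (s j)\<bar>))"
        using C by (intro mult_left_mono) auto
      then show ?thesis using est[OF s(1)[of j]] by linarith
    qed
    have lim1: "(\<lambda>j. norm (s j)) \<longlonglongrightarrow> norm x" using s(2) by (rule tendsto_norm)
    have lim2: "(\<lambda>j. C * (2 * (n x + M * norm (s j - x)) + (\<Sum>l\<in>\<Phi>. \<bar>blinfun_apply l (s j)\<bar>)))
        \<longlonglongrightarrow> C * (2 * (n x + M * norm (x - x)) + (\<Sum>l\<in>\<Phi>. \<bar>blinfun_apply l x\<bar>))"
      using s(2) by (intro tendsto_intros)
    have "norm x \<le> C * (2 * (n x + M * norm (x - x)) + (\<Sum>l\<in>\<Phi>. \<bar>blinfun_apply l x\<bar>))"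
      using ineq by (intro LIMSEQ_le[OF lim1 lim2]) auto
    also have "\<dots> \<le> C * (2 * n x + 2 * (\<Sum>l\<in>\<Phi>. \<bar>blinfun_apply l x\<bar>))"
      using C sum_nonneg[of \<Phi> "\<lambda>l. \<bar>blinfun_apply l x\<bar>"] by (intro mult_left_mono) auto
    finally show ?thesis by (simp add: algebra_simps)
  qed
  then show ?thesis using that[of \<Phi> "2 * C"] \<Phi> C by auto
next
  case False
  obtain k :: "'v dual" where k: "k w = 1" "\<And>h. h \<in> H \<Longrightarrow> k h = 0"
    using separating_functional[OF H(1) False] by metis
  define \<Psi> where "\<Psi> = insert k \<Phi>"
  define R where "R = 2 * \<bar>M\<bar> * norm w + (\<Sum>l\<in>\<Phi>. \<bar>blinfun_apply l w\<bar>)"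
  define C' where "C' = 2 * C + C * R + norm w"
  have R: "R \<ge> 0" by (auto simp: R_def intro!: add_nonneg_nonneg sum_nonneg)
  have "norm x \<le> C' * (n x + (\<Sum>l\<in>\<Psi>. \<bar>blinfun_apply l x\<bar>))" if x: "x = h + a *\<^sub>R w" and h: "h \<in> H" for x h a
  proof -
    let ?s = "\<Sum>l\<in>\<Phi>. \<bar>blinfun_apply l x\<bar>" and ?t = "\<Sum>l\<in>\<Psi>. \<bar>blinfun_apply l x\<bar>"
    have kx: "blinfun_apply k x = a" using k h by (simp add: x blinfun.bilinear_simps)
    have awE: "(- a) *\<^sub>R w \<in> E" using E w by (rule subspace_scale)
    have xE: "x \<in> E" using x h w H(2) E by (auto intro: subspace_add subspace_scale)
    \<comment> \<open>every term of the bound is dominated by n x + ?t: the old functionals by monotonicity, the coefficient a because it is the value of k\<close>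
    have st: "?s \<le> ?t" unfolding \<Psi>_def using \<Phi> by (intro sum_mono2) auto
    have at: "\<bar>a\<bar> \<le> ?t"
      using member_le_sum[of k \<Psi> "\<lambda>l. \<bar>blinfun_apply l x\<bar>"] \<Phi> kx by (simp add: \<Psi>_def)
    have heq: "h = x + (- a) *\<^sub>R w" by (simp add: x)
    have "n h \<le> 2 * (n x + n ((- a) *\<^sub>R w))" unfolding heq using xE awE by (rule nadd)
    also have "n ((- a) *\<^sub>R w) \<le> M * (\<bar>a\<bar> * norm w)" using nM[OF awE] by simp
    also have "\<dots> \<le> \<bar>M\<bar> * (\<bar>a\<bar> * norm w)" by (intro mult_right_mono) auto
    finally have nh: "n h \<le> 2 * n x + 2 * \<bar>M\<bar> * norm w * \<bar>a\<bar>" by (simp add: algebra_simps)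
    have "(\<Sum>l\<in>\<Phi>. \<bar>blinfun_apply l h\<bar>) \<le> (\<Sum>l\<in>\<Phi>. \<bar>blinfun_apply l x\<bar> + \<bar>a\<bar> * \<bar>blinfun_apply l w\<bar>)"
    proof (rule sum_mono)
      fix l
      show "\<bar>blinfun_apply l h\<bar> \<le> \<bar>blinfun_apply l x\<bar> + \<bar>a\<bar> * \<bar>blinfun_apply l w\<bar>"
        unfolding heq using abs_triangle_ineq4[of "blinfun_apply l x" "a * blinfun_apply l w"]
        by (simp add: blinfun.bilinear_simps abs_mult)
    qed
    also have "\<dots> = ?s + \<bar>a\<bar> * (\<Sum>l\<in>\<Phi>. \<bar>blinfun_apply l w\<bar>)"
      by (simp add: sum.distrib sum_distrib_left)
    finally have sh: "(\<Sum>l\<in>\<Phi>. \<bar>blinfun_apply l h\<bar>) \<le> ?s + \<bar>a\<bar> * (\<Sum>l\<in>\<Phi>. \<bar>blinfun_apply l w\<bar>)" .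
    have "norm x \<le> norm h + \<bar>a\<bar> * norm w"
      unfolding x using norm_triangle_ineq[of h "a *\<^sub>R w"] by simp
    also have "norm h \<le> C * (n h + (\<Sum>l\<in>\<Phi>. \<bar>blinfun_apply l h\<bar>))" by (rule est[OF h])
    also have "\<dots> \<le> C * (2 * n x + ?s + R * \<bar>a\<bar>)"
      using nh sh C by (intro mult_left_mono) (auto simp: R_def algebra_simps)
    also have "\<dots> \<le> C * (2 * (n x + ?t) + R * (n x + ?t))"
      using C R st at n0[OF xE] by (intro mult_left_mono add_mono) auto
    also have "\<bar>a\<bar> * norm w \<le> (n x + ?t) * norm w" using at n0[OF xE] by (intro mult_right_mono) auto
    finally show ?thesis by (simp add: C'_def algebra_simps)
  qed
  moreover have "C' > 0" unfolding C'_def using C R by (intro add_pos_nonneg) auto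
  moreover have "finite \<Psi>" using \<Phi> by (simp add: \<Psi>_def)
  ultimately show ?thesis using that[of \<Psi> C'] by auto
qed

text \<open>
  The dimensions of a complement of \<open>Y\<close> are added one at a time. The estimate is only ever
  asserted on the part inside \<open>E\<close>, the space of admissible data: the complementing vectors
  need not lie in \<open>E\<close>, and a step that enlarges this part does so by exactly one direction.
\<close>

lemma estimate_modulo_finitely_many_functionals:
  fixes n :: "'v::real_normed_vector \<Rightarrow> real"
  assumes E: "subspace E"
    and n0: "\<And>x. x \<in> E \<Longrightarrow> 0 \<le> n x"
    and nM: "\<And>x. x \<in> E \<Longrightarrow> n x \<le> M * norm x"
    and nadd: "\<And>x y. x \<in> E \<Longrightarrow> y \<in> E \<Longrightarrow> n (x + y) \<le> 2 * (n x + n y)"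
    and Y: "finite_codimensional Y" and C: "C > 0"
    and est: "\<And>x. x \<in> E \<inter> Y \<Longrightarrow> norm x \<le> C * n x"
  shows "\<exists>\<Phi> C'. finite \<Phi> \<and> C' > 0 \<and>
    (\<forall>x\<in>E. norm x \<le> C' * (n x + (\<Sum>l\<in>\<Phi>. \<bar>blinfun_apply l x\<bar>)))"
proof -
  obtain Z where Ys: "subspace Y" and Z: "finite Z" "span (Y \<union> Z) = UNIV"
    using Y unfolding finite_codimensional_def by blast
  have "\<exists>\<Phi> C'. finite \<Phi> \<and> C' > 0 \<and>
      (\<forall>x\<in>E \<inter> span (Y \<union> Z). norm x \<le> C' * (n x + (\<Sum>l\<in>\<Phi>. \<bar>blinfun_apply l x\<bar>)))"
    using Z(1)
  proof (induction Z)
    case empty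
    have "span (Y \<union> {}) = Y" using Ys by (simp add: span_eq_iff)
    then show ?case unfolding \<open>span (Y \<union> {}) = Y\<close> using est C by (intro exI[of _ "{}"] exI[of _ C]) auto
  next
    case (insert z Z)
    define H where "H = E \<inter> span (Y \<union> Z)"
    define H' where "H' = E \<inter> span (Y \<union> insert z Z)"
    have H: "subspace H" "H \<subseteq> E" unfolding H_def using E by (auto intro: subspace_inter)
    obtain \<Phi> C1 where \<Phi>: "finite \<Phi>" "C1 > 0"
      "\<And>x. x \<in> H \<Longrightarrow> norm x \<le> C1 * (n x + (\<Sum>l\<in>\<Phi>. \<bar>blinfun_apply l x\<bar>))"
      using insert.IH unfolding H_def by blast
    show ?case
    proof (cases "H' \<subseteq> H")
      case True
      then show ?thesis using \<Phi> unfolding H'_def by blast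
    next
      case False
      then obtain w where w: "w \<in> H'" "w \<notin> H" by blast
      have wE: "w \<in> E" using w(1) by (simp add: H'_def)
      have span_z: "span (Y \<union> insert z Z) = {x. \<exists>b. x - b *\<^sub>R z \<in> span (Y \<union> Z)}"
        using span_insert[of z "Y \<union> Z"] by simp
      obtain b where b: "w - b *\<^sub>R z \<in> span (Y \<union> Z)" using w(1) span_z by (auto simp: H'_def)
      have "b \<noteq> 0" using b w(2) wE by (auto simp: H_def)
      obtain \<Psi> C' where \<Psi>: "finite \<Psi>" "C' > 0"
        "\<And>h a. h \<in> H \<Longrightarrow> norm (h + a *\<^sub>R w) \<le> C' * (n (h + a *\<^sub>R w) + (\<Sum>l\<in>\<Psi>. \<bar>blinfun_apply l (h + a *\<^sub>R w)\<bar>))"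
        using estimate_add_dimension[OF E n0 nM nadd H wE \<Phi>] by blast
      have "norm x \<le> C' * (n x + (\<Sum>l\<in>\<Psi>. \<bar>blinfun_apply l x\<bar>))" if x: "x \<in> H'" for x
      proof -
        obtain a where a: "x - a *\<^sub>R z \<in> span (Y \<union> Z)" using x span_z by (auto simp: H'_def)
        \<comment> \<open>b is nonzero because w does not lie in the smaller span, so w can replace z as the new direction\<close>
        have "(x - a *\<^sub>R z) - (a / b) *\<^sub>R (w - b *\<^sub>R z) \<in> span (Y \<union> Z)"
          by (rule span_diff[OF a span_scale[OF b]])
        moreover have "(x - a *\<^sub>R z) - (a / b) *\<^sub>R (w - b *\<^sub>R z) = x - (a / b) *\<^sub>R w"
          using \<open>b \<noteq> 0\<close> by (simp add: algebra_simps)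
        moreover have "x - (a / b) *\<^sub>R w \<in> E"
          using x wE E by (auto simp: H'_def intro: subspace_diff subspace_scale)
        ultimately have "x - (a / b) *\<^sub>R w \<in> H" by (simp add: H_def)
        from \<Psi>(3)[OF this, of "a / b"] show ?thesis by simp
      qed
      then show ?thesis using \<Psi>(1,2) unfolding H'_def by blast
    qed
  qed
  then show ?thesis using Z(2) by simp
qed

section \<open>Finite-rank operators into a carrier set\<close>

text \<open>
  Since the square of an infinite set is equipotent to it, a finite-dimensional coordinate space
  embeds into the reals as a bare set.
\<close>

lemma ex_inj_finite_support_real:
  assumes "finite I"
  shows "\<exists>j :: ('i \<Rightarrow> real) \<Rightarrow> real. inj_on j {c. \<forall>i. i \<notin> I \<longrightarrow> c i = 0}"
  using assms
proof (induction I)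
  case empty
  show ?case by (rule exI[of _ "\<lambda>_. 0"]) (auto simp: inj_on_def)
next
  case (insert k I)
  then obtain j :: "('i \<Rightarrow> real) \<Rightarrow> real" where j: "inj_on j {c. \<forall>i. i \<notin> I \<longrightarrow> c i = 0}" by blast
  have "(card_of ((UNIV :: real set) \<times> (UNIV :: real set)), card_of (UNIV :: real set)) \<in> ordIso"
    by (rule card_of_Times_same_infinite) (rule infinite_UNIV_char_0)
  then obtain f :: "real \<times> real \<Rightarrow> real" where f: "inj f"
    unfolding card_of_ordIso[symmetric] bij_betw_def by auto
  have "inj_on (\<lambda>c. f (c k, j (c(k := 0)))) {c. \<forall>i. i \<notin> insert k I \<longrightarrow> c i = 0}"
  proof (rule inj_onI)
    fix c d :: "'i \<Rightarrow> real"
    assume c: "c \<in> {c. \<forall>i. i \<notin> insert k I \<longrightarrow> c i = 0}" and d: "d \<in> {c. \<forall>i. i \<notin> insert k I \<longrightarrow> c i = 0}"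
      and "f (c k, j (c(k := 0))) = f (d k, j (d(k := 0)))"
    then have eq: "c k = d k" "j (c(k := 0)) = j (d(k := 0))" using f by (auto dest: injD)
    have "c(k := 0) = d(k := 0)" using c d eq(2) by (intro inj_onD[OF j]) auto
    then show "c = d" using eq(1) by (metis fun_upd_triv fun_upd_upd)
  qed
  then show ?case by blast
qed

lemma banach_space_on_image:
  assumes "banach_space_on X zero add smul nrm" and j: "inj_on j X"
  defines "i \<equiv> inv_into X j"
  shows "banach_space_on (j ` X) (j zero) (\<lambda>x y. j (add (i x) (i y))) (\<lambda>a x. j (smul a (i x)))
    (\<lambda>x. nrm (i x))"
proof -
  interpret banach_space_on X zero add smul nrm by fact
  have ij[simp]: "i (j x) = x" if "x \<in> X" for x using that j by (simp add: i_def)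
  show ?thesis
  proof (unfold_locales, goal_cases)
    case (16 \<sigma>)
    have iX: "i (\<sigma> n) \<in> X" for n using 16(1)[of n] by auto
    have "\<exists>x\<in>X. (\<lambda>n. nrm (add (i (\<sigma> n)) (smul (- 1) x))) \<longlonglongrightarrow> 0"
      using 16(2) iX add_in smul_in by (intro complete) simp_all
    then obtain x where x: "x \<in> X" "(\<lambda>n. nrm (add (i (\<sigma> n)) (smul (- 1) x))) \<longlonglongrightarrow> 0" by blast
    then show ?case using iX add_in smul_in by (intro bexI[of _ "j x"]) auto
  next
    case (13 x)
    then show ?case using nrm_eq_0 inj_on_eq_iff[OF j] zero_in by auto
  next
    case (5 x y)
    then show ?case using add_commute by auto
  qed (auto simp: add_in smul_in zero_in add_assoc add_zero add_neg smul_add_right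
      smul_add_left smul_smul smul_one nrm_nonneg nrm_smul nrm_triangle)
qed

lemma banach_space_on_finite_support:
  assumes I: "finite I"
  shows "banach_space_on {c :: 'i \<Rightarrow> real. \<forall>i. i \<notin> I \<longrightarrow> c i = 0} (\<lambda>_. 0) (\<lambda>c d i. c i + d i)
    (\<lambda>a c i. a * c i) (\<lambda>c. \<Sum>i\<in>I. \<bar>c i\<bar>)"
proof (unfold_locales, goal_cases)
  case (13 c)
  then show ?case using I by (auto simp: sum_nonneg_eq_0_iff)
next
  case (16 \<sigma>)
  have "Cauchy (\<lambda>n. \<sigma> n i)" for i
  proof (cases "i \<in> I")
    case True
    have le: "\<bar>\<sigma> m i - \<sigma> n i\<bar> \<le> (\<Sum>i\<in>I. \<bar>\<sigma> m i + - 1 * \<sigma> n i\<bar>)" for m n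
      using member_le_sum[of i I "\<lambda>i. \<bar>\<sigma> m i + - 1 * \<sigma> n i\<bar>"] True I by simp
    show ?thesis
    proof (rule CauchyI)
      fix e :: real assume "e > 0"
      then obtain N where "\<forall>m\<ge>N. \<forall>n\<ge>N. (\<Sum>i\<in>I. \<bar>\<sigma> m i + - 1 * \<sigma> n i\<bar>) < e" using 16(2) by blast
      then have "\<forall>m\<ge>N. \<forall>n\<ge>N. norm (\<sigma> m i - \<sigma> n i) < e"
        unfolding real_norm_def using le le_less_trans by blast
      then show "\<exists>N. \<forall>m\<ge>N. \<forall>n\<ge>N. norm (\<sigma> m i - \<sigma> n i) < e" by blast
    qed
  next
    case False
    then have "\<sigma> n i = 0" for n using 16(1)[of n] by simp
    then show ?thesis by (simp add: Cauchy_def)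
  qed
  then have "\<forall>i. \<exists>y. (\<lambda>n. \<sigma> n i) \<longlonglongrightarrow> y" by (simp add: Cauchy_convergent_iff convergent_def)
  then obtain c where c: "\<And>i. (\<lambda>n. \<sigma> n i) \<longlonglongrightarrow> c i" by metis
  have "c i = 0" if "i \<notin> I" for i
  proof -
    have "(\<lambda>n. \<sigma> n i) = (\<lambda>n. 0)" using 16(1) that by auto
    then show ?thesis using c[of i] by (simp add: LIMSEQ_const_iff)
  qed
  moreover have "(\<lambda>n. \<Sum>i\<in>I. \<bar>\<sigma> n i + - 1 * c i\<bar>) \<longlonglongrightarrow> (\<Sum>i\<in>I. \<bar>c i + - 1 * c i\<bar>)"
    by (intro tendsto_intros c)
  ultimately show ?case by (intro bexI[of _ c]) auto
next
  case 14
  show ?case by (simp add: abs_mult sum_distrib_left)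
next
  case 15
  show ?case unfolding sum.distrib[symmetric] by (intro sum_mono abs_triangle_ineq)
qed (auto simp: algebra_simps intro!: sum_nonneg)

lemma common_convergent_subsequence:
  fixes f :: "nat \<Rightarrow> 'v::real_normed_vector" and \<Phi> :: "'v dual set"
  assumes "finite \<Phi>" and f: "bounded (range f)"
  shows "\<exists>r::nat \<Rightarrow> nat. strict_mono r \<and> (\<forall>l\<in>\<Phi>. convergent (\<lambda>n. blinfun_apply l (f (r n))))"
  using assms(1)
proof (induction \<Phi>)
  case empty
  show ?case by (intro exI[of _ "\<lambda>n. n"]) (simp add: strict_mono_def)
next
  case (insert k \<Phi>)
  then obtain r :: "nat \<Rightarrow> nat" where r: "strict_mono r"
    "\<And>l. l \<in> \<Phi> \<Longrightarrow> convergent (\<lambda>n. blinfun_apply l (f (r n)))" by blast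
  have "bounded (blinfun_apply k ` range f)"
    by (intro bounded_linear_image f blinfun.bounded_linear_right)
  then have "bounded (range (\<lambda>n. blinfun_apply k (f (r n))))" by (rule bounded_subset) auto
  then obtain s y where s: "strict_mono (s :: nat \<Rightarrow> nat)" "((\<lambda>n. blinfun_apply k (f (r n))) \<circ> s) \<longlonglongrightarrow> y"
    using bounded_imp_convergent_subsequence by blast
  have "convergent (\<lambda>n. blinfun_apply l (f ((r \<circ> s) n)))" if "l \<in> insert k \<Phi>" for l
  proof (cases "l = k")
    case True
    then show ?thesis using s(2) by (auto simp: convergent_def comp_def)
  next
    case False
    then show ?thesis using convergent_subseq_convergent[OF r(2) s(1), of l] that by (simp add: comp_def)
  qed
  then show ?case using strict_mono_o[OF r(1) s(1)] by blast
qed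

text \<open>
  The target is \<open>\<real>\<^sup>\<Phi>\<close> with the sum norm, its points encoded as reals; the operator
  evaluates all functionals at once. It is compact by the Bolzano-Weierstrass theorem in each
  coordinate.
\<close>

lemma ex_compact_operator_norm_sum:
  fixes \<Phi> :: "'v::real_normed_vector dual set"
  assumes \<Phi>: "finite \<Phi>"
  shows "\<exists>(X :: ('x + real) set) zero add smul nrm (G :: 'v \<Rightarrow> 'x + real).
    banach_space_on X zero add smul nrm \<and> compact_operator_into X add smul nrm G \<and>
    (\<forall>x. nrm (G x) = (\<Sum>l\<in>\<Phi>. \<bar>blinfun_apply l x\<bar>))"
proof -
  let ?X = "{c :: 'v dual \<Rightarrow> real. \<forall>l. l \<notin> \<Phi> \<longrightarrow> c l = 0}"
  obtain j0 :: "('v dual \<Rightarrow> real) \<Rightarrow> real" where j0: "inj_on j0 ?X"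
    using ex_inj_finite_support_real[OF \<Phi>] by blast
  define j :: "('v dual \<Rightarrow> real) \<Rightarrow> 'x + real" where "j c = Inr (j0 c)" for c
  have j: "inj_on j ?X" using j0 by (auto simp: j_def inj_on_def)
  let ?i = "inv_into ?X j"
  have ij: "?i (j c) = c" if "c \<in> ?X" for c using that by (rule inv_into_f_f[OF j])
  define add where "add x y = j (\<lambda>l. ?i x l + ?i y l)" for x y
  define smul where "smul a x = j (\<lambda>l. a * ?i x l)" for a x
  define nrm where "nrm x = (\<Sum>l\<in>\<Phi>. \<bar>?i x l\<bar>)" for x
  define c where "c x l = (if l \<in> \<Phi> then blinfun_apply l x else 0)" for x l
  define G where "G x = j (c x)" for x
  have cX: "c x \<in> ?X" for x by (simp add: c_def)
  have iG: "?i (G x) = c x" for x unfolding G_def by (rule ij[OF cX])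
  have B: "banach_space_on (j ` ?X) (j (\<lambda>_. 0)) add smul nrm"
    using banach_space_on_image[OF banach_space_on_finite_support[OF \<Phi>] j]
    unfolding add_def[abs_def] smul_def[abs_def] nrm_def[abs_def] .
  have "compact_operator_into (j ` ?X) add smul nrm G"
    unfolding compact_operator_into_def
  proof (intro conjI allI impI)
    show "G x \<in> j ` ?X" for x using cX by (simp add: G_def)
    show "G (x + y) = add (G x) (G y)" for x y
      unfolding add_def iG unfolding G_def by (rule arg_cong[of _ _ j]) (auto simp: c_def blinfun.bilinear_simps)
    show "G (a *\<^sub>R x) = smul a (G x)" for a x
      unfolding smul_def iG unfolding G_def by (rule arg_cong[of _ _ j]) (auto simp: c_def blinfun.bilinear_simps)
    fix f :: "nat \<Rightarrow> 'v" assume "bounded (range f)"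
    then obtain r :: "nat \<Rightarrow> nat" where r: "strict_mono r"
      "\<And>l. l \<in> \<Phi> \<Longrightarrow> convergent (\<lambda>n. blinfun_apply l (f (r n)))"
      using common_convergent_subsequence[OF \<Phi>] by blast
    define y where "y l = (if l \<in> \<Phi> then lim (\<lambda>n. blinfun_apply l (f (r n))) else 0)" for l
    have y: "y \<in> ?X" by (simp add: y_def)
    have ym: "(\<lambda>l. - 1 * y l) \<in> ?X" by (simp add: y_def)
    have sX: "(\<lambda>l. c x l + - 1 * y l) \<in> ?X" for x by (simp add: c_def y_def)
    have eq: "nrm (add (G x) (smul (- 1) (j y))) = (\<Sum>l\<in>\<Phi>. \<bar>c x l + - 1 * y l\<bar>)" for x
      unfolding nrm_def add_def smul_def iG ij[OF y] ij[OF ym] ij[OF sX] ..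
    have "(\<lambda>n. c (f (r n)) l) \<longlonglongrightarrow> y l" if "l \<in> \<Phi>" for l
      using r(2)[OF that] that by (simp add: c_def y_def convergent_LIMSEQ_iff)
    then have "(\<lambda>n. \<Sum>l\<in>\<Phi>. \<bar>c (f (r n)) l + - 1 * y l\<bar>) \<longlonglongrightarrow> (\<Sum>l\<in>\<Phi>. \<bar>y l + - 1 * y l\<bar>)"
      by (intro tendsto_intros)
    then have "(\<lambda>n. nrm (add (G (f (r n))) (smul (- 1) (j y)))) \<longlonglongrightarrow> 0" unfolding eq by simp
    then show "\<exists>x\<in>j ` ?X. \<exists>r::nat \<Rightarrow> nat. strict_mono r \<and>
        (\<lambda>n. nrm (add (G (f (r n))) (smul (- 1) x))) \<longlonglongrightarrow> 0" using r(1) y by blast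
  qed
  moreover have "nrm (G x) = (\<Sum>l\<in>\<Phi>. \<bar>blinfun_apply l x\<bar>)" for x
    unfolding nrm_def iG by (simp add: c_def)
  ultimately show ?thesis using B by blast
qed

section \<open>The uniform boundedness principle\<close>

text \<open>
  A gliding hump argument. For any center \<open>x\<close> and radius \<open>r\<close>, the identity
  \<open>2 L u = L (x + u) - L (x - u)\<close> provides a point of the ball at which \<open>L\<close> has norm at
  least \<open>2 / 3 * r * norm L\<close>. Steps of radius \<open>(1 / 3) ^ n\<close> converge geometrically, and the
  total of the later steps, at most \<open>1 / 2 * (1 / 3) ^ n\<close>, is too short to undo the growth
  reached at step \<open>n\<close>; operators of norm at least \<open>4 ^ n\<close> are therefore unbounded at
  the limit.
\<close>

lemma uniform_boundedness:
  fixes T :: "nat \<Rightarrow> 'a::banach \<Rightarrow>\<^sub>L 'b::real_normed_vector"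
  assumes pointwise: "\<And>x. bounded (range (\<lambda>n. blinfun_apply (T n) x))"
  shows "bounded (range T)"
proof (rule ccontr)
  assume unb: "\<not> bounded (range T)"
  have "\<exists>m. norm (T m) \<ge> 4 ^ n" for n :: nat
  proof (rule ccontr)
    assume "\<not> ?thesis"
    then have "\<forall>m. norm (T m) \<le> 4 ^ n" by (meson le_cases not_le)
    then have "bounded (range T)" unfolding bounded_iff by auto
    then show False using unb by simp
  qed
  then obtain m where m: "\<And>n::nat. norm (T (m n)) \<ge> 4 ^ n" by metis
  have step: "\<exists>z. norm (z - x) \<le> r \<and> norm (L z) \<ge> 2 / 3 * r * norm L"
    if r: "r > 0" for L :: "'a \<Rightarrow>\<^sub>L 'b" and x r
  proof (rule ccontr)
    assume "\<not> ?thesis"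
    then have small: "norm (L z) < 2 / 3 * r * norm L" if "norm (z - x) \<le> r" for z
      using that by (meson not_less)
    have pos: "norm L > 0"
    proof (rule ccontr)
      assume "\<not> norm L > 0"
      then show False using small[of x] r by simp
    qed
    have "norm (L y) \<le> 2 / 3 * norm L * norm y" for y
    proof (cases "y = 0")
      case False
      define u where "u = (r / norm y) *\<^sub>R y"
      have u: "norm u = r" using False r by (simp add: u_def)
      have "2 *\<^sub>R L u = L (x + u) - L (x - u)" by (simp add: blinfun.bilinear_simps scaleR_2)
      then have "2 * norm (L u) \<le> norm (L (x + u)) + norm (L (x - u))"
        using norm_triangle_ineq4[of "L (x + u)" "L (x - u)"] by (metis norm_scaleR abs_numeral)
      also have "\<dots> \<le> 2 * (2 / 3 * r * norm L)"
        using small[of "x + u"] small[of "x - u"] u by simp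
      finally have "norm (L u) \<le> 2 / 3 * r * norm L" by simp
      moreover have "norm (L u) = r / norm y * norm (L y)"
        using r by (simp add: u_def blinfun.bilinear_simps)
      ultimately show ?thesis using r False by (simp add: field_simps)
    qed (simp add: blinfun.bilinear_simps)
    then have "norm L \<le> 2 / 3 * norm L" by (intro norm_blinfun_bound) auto
    then show False using pos by simp
  qed
  have "\<exists>x. \<forall>n. norm (x (Suc n) - x n) \<le> (1 / 3) ^ n \<and>
      norm (blinfun_apply (T (m n)) (x (Suc n))) \<ge> 2 / 3 * (1 / 3) ^ n * norm (T (m n))"
    using dependent_nat_choice[of "\<lambda>_ _. True"
      "\<lambda>n x z. norm (z - x) \<le> (1 / 3) ^ n \<and> norm (blinfun_apply (T (m n)) z) \<ge> 2 / 3 * (1 / 3) ^ n * norm (T (m n))"]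
      step by auto
  then obtain x where x: "\<And>n. norm (x (Suc n) - x n) \<le> (1 / 3) ^ n"
    "\<And>n. norm (blinfun_apply (T (m n)) (x (Suc n))) \<ge> 2 / 3 * (1 / 3) ^ n * norm (T (m n))" by blast
  have tail: "norm (x (k + n) - x n) \<le> 3 / 2 * (1 / 3) ^ n - 3 / 2 * (1 / 3) ^ (k + n)" for k n
  proof (induction k)
    case (Suc k)
    have "norm (x (Suc k + n) - x n) \<le> norm (x (Suc (k + n)) - x (k + n)) + norm (x (k + n) - x n)"
      using norm_triangle_ineq[of "x (Suc (k + n)) - x (k + n)" "x (k + n) - x n"] by simp
    then show ?case using Suc x(1)[of "k + n"] by simp
  qed simp
  have tail': "norm (x j - x n) \<le> 3 / 2 * (1 / 3) ^ n" if "j \<ge> n" for j n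
  proof -
    have "norm (x j - x n) \<le> 3 / 2 * (1 / 3) ^ n - 3 / 2 * (1 / 3) ^ j"
      using tail[of "j - n" n] that by simp
    moreover have "(0 :: real) \<le> (1 / 3) ^ j" by simp
    ultimately show ?thesis by linarith
  qed
  have "Cauchy x"
  proof (rule CauchyI)
    fix e :: real assume "e > 0"
    then obtain N where N: "(1 / 3 :: real) ^ N < e / 3" using real_arch_pow_inv[of "e / 3" "1 / 3"] by auto
    have "norm (x i - x j) < e" if "i \<ge> N" "j \<ge> N" for i j
      using norm_triangle_ineq4[of "x i - x N" "x j - x N"] tail'[OF that(1)] tail'[OF that(2)] N by simp
    then show "\<exists>N. \<forall>i\<ge>N. \<forall>j\<ge>N. norm (x i - x j) < e" by blast
  qed
  then obtain y where y: "x \<longlonglongrightarrow> y" using Cauchy_convergent_iff convergent_def by blast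
  have near: "norm (y - x n) \<le> 3 / 2 * (1 / 3) ^ n" for n
    using tail' by (intro LIMSEQ_le_const2[OF tendsto_norm[OF tendsto_diff[OF y tendsto_const]]]) blast
  have large: "norm (blinfun_apply (T (m n)) y) \<ge> 1 / 6 * (4 / 3) ^ n" for n
  proof -
    have "norm (blinfun_apply (T (m n)) (x (Suc n)))
        \<le> norm (blinfun_apply (T (m n)) y) + norm (blinfun_apply (T (m n)) (y - x (Suc n)))"
      using norm_triangle_ineq4[of "blinfun_apply (T (m n)) y" "blinfun_apply (T (m n)) (y - x (Suc n))"]
      by (simp add: blinfun.bilinear_simps)
    also have "norm (blinfun_apply (T (m n)) (y - x (Suc n))) \<le> norm (T (m n)) * (1 / 2 * (1 / 3) ^ n)"
      using near[of "Suc n"] by (intro order_trans[OF norm_blinfun mult_left_mono]) auto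
    finally have "norm (blinfun_apply (T (m n)) y) \<ge> 1 / 6 * (1 / 3) ^ n * norm (T (m n))"
      using x(2)[of n] by (simp add: algebra_simps)
    moreover have "1 / 6 * (1 / 3) ^ n * norm (T (m n)) \<ge> 1 / 6 * (1 / 3) ^ n * 4 ^ n"
      using m[of n] by (intro mult_left_mono) auto
    ultimately show ?thesis by (simp add: power_mult_distrib[symmetric] power_divide)
  qed
  obtain b where b: "\<And>n. norm (blinfun_apply (T n) y) \<le> b"
    using pointwise[of y] unfolding bounded_iff by auto
  obtain n :: nat where "6 * b < (4 / 3) ^ n" using real_arch_pow[of "4 / 3" "6 * b"] by auto
  then show False using large[of n] b[of "m n"] by linarith
qed

section \<open>Uniqueness of the semigroup of a generator\<close>

lemma C0_semigroupD:
  assumes "C0_semigroup S"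
  shows "S 0 = id_blinfun"
    and "s \<ge> 0 \<Longrightarrow> t \<ge> 0 \<Longrightarrow> blinfun_apply (S (s + t)) x = S s (S t x)"
    and "((\<lambda>t. blinfun_apply (S t) x) \<longlongrightarrow> x) (at_right 0)"
  using assms unfolding C0_semigroup_def by (auto simp: blinfun_apply_blinfun_compose)

text \<open>
  If the semigroup were unbounded near \<open>0\<close>, a null sequence of times would contradict the
  uniform boundedness principle; the semigroup law then carries a bound on a short interval to any
  bounded interval.
\<close>

lemma C0_semigroup_bounded:
  fixes S :: "real \<Rightarrow> 'a::banach \<Rightarrow>\<^sub>L 'a"
  assumes S: "C0_semigroup S"
  obtains M where "M \<ge> 1" "\<And>t. 0 \<le> t \<Longrightarrow> t \<le> T \<Longrightarrow> norm (S t) \<le> M"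
proof -
  have "\<exists>N::nat. \<forall>t. 0 \<le> t \<and> t \<le> 1 / Suc N \<longrightarrow> norm (S t) \<le> Suc N"
  proof (rule ccontr)
    assume "\<not> ?thesis"
    then have "\<forall>n::nat. \<exists>t. 0 \<le> t \<and> t \<le> 1 / Suc n \<and> norm (S t) > Suc n" by (meson not_le)
    then obtain t where t: "\<And>n::nat. 0 \<le> t n" "\<And>n. t n \<le> 1 / Suc n" "\<And>n. norm (S (t n)) > Suc n"
      by metis
    have pos: "t n > 0" for n
    proof (rule ccontr)
      assume "\<not> t n > 0"
      then have "t n = 0" using t(1)[of n] by simp
      then have "norm (S (t n)) \<le> 1" using C0_semigroupD(1)[OF S] norm_blinfun_id_le by simp
      then show False using t(3)[of n] by simp
    qed
    have "t \<longlonglongrightarrow> 0"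
      by (rule real_tendsto_sandwich[OF _ _ tendsto_const LIMSEQ_inverse_real_of_nat])
        (use t(1,2) in \<open>auto simp: field_simps\<close>)
    then have "filterlim t (at_right 0) sequentially"
      using pos by (intro filterlim_at_withinI) auto
    then have "(\<lambda>n. blinfun_apply (S (t n)) x) \<longlonglongrightarrow> x" for x
      by (rule filterlim_compose[OF C0_semigroupD(3)[OF S]])
    then have "bounded (range (\<lambda>n. blinfun_apply (S (t n)) x))" for x
      by (intro convergent_imp_bounded) (auto simp: convergent_def)
    then have "bounded (range (\<lambda>n. S (t n)))" by (rule uniform_boundedness)
    then obtain b where "\<And>n. norm (S (t n)) \<le> b" unfolding bounded_iff by auto
    then have "real (Suc n) < b" for n using t(3)[of n] by (meson less_le_trans)
    then show False using reals_Archimedean2[of b] by (meson less_Suc_eq less_asym of_nat_less_iff order_less_trans)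
  qed
  then obtain N :: nat where N: "\<And>t. 0 \<le> t \<Longrightarrow> t \<le> 1 / Suc N \<Longrightarrow> norm (S t) \<le> Suc N" by blast
  have bound: "norm (S t) \<le> real (Suc N) ^ Suc k" if "0 \<le> t" "t \<le> Suc k / Suc N" for k t
    using that
  proof (induction k arbitrary: t)
    case 0
    then show ?case using N by simp
  next
    case (Suc k)
    let ?d = "1 / real (Suc N)"
    show ?case
    proof (cases "t \<le> ?d")
      case True
      then have "norm (S t) \<le> Suc N" using N Suc.prems by simp
      also have "real (Suc N) \<le> real (Suc N) ^ Suc (Suc k)" by (rule self_le_power) simp_all
      finally show ?thesis .
    next
      case False
      have t: "S t = S ?d o\<^sub>L S (t - ?d)"
        using S False unfolding C0_semigroup_def
        by (metis add.commute diff_add_cancel diff_ge_0_iff_ge nle_le of_nat_0_le_iff zero_le_divide_1_iff)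
      have "norm (S (t - ?d)) \<le> real (Suc N) ^ Suc k"
      proof (rule Suc.IH)
        show "0 \<le> t - ?d" using False by simp
        have "real (Suc (Suc k)) / real (Suc N) = real (Suc k) / real (Suc N) + ?d"
          by (simp add: add_divide_distrib)
        then show "t - ?d \<le> real (Suc k) / real (Suc N)" using Suc.prems(2) by simp
      qed
      moreover have "norm (S ?d) \<le> Suc N" by (intro N) auto
      ultimately have "norm (S ?d) * norm (S (t - ?d)) \<le> real (Suc N) * real (Suc N) ^ Suc k"
        by (intro mult_mono) auto
      then show ?thesis unfolding t using norm_blinfun_compose[of "S ?d" "S (t - ?d)"] by simp
    qed
  qed
  obtain k :: nat where k: "T * Suc N < k" using reals_Archimedean2 by blast
  have "norm (S t) \<le> real (Suc N) ^ Suc k" if "0 \<le> t" "t \<le> T" for t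
  proof (rule bound[OF that(1)])
    have "t * Suc N \<le> T * Suc N" using that by (intro mult_right_mono) auto
    then show "t \<le> Suc k / Suc N" using k by (simp add: field_simps)
  qed
  moreover have "1 \<le> real (Suc N) ^ Suc k" by (rule one_le_power) simp
  ultimately show ?thesis by (intro that[of "real (Suc N) ^ Suc k"]) auto
qed

lemma C0_semigroup_continuous:
  fixes S :: "real \<Rightarrow> 'a::banach \<Rightarrow>\<^sub>L 'a"
  assumes S: "C0_semigroup S"
  shows "continuous_on {0..T} (\<lambda>t. blinfun_apply (S t) x)"
proof -
  obtain M where M: "M \<ge> 1" "\<And>t. 0 \<le> t \<Longrightarrow> t \<le> T \<Longrightarrow> norm (S t) \<le> M"
    using C0_semigroup_bounded[OF S] by metis
  have le: "norm (S t x - S s x) \<le> M * norm (S (t - s) x - x)" if "0 \<le> s" "s \<le> t" "t \<le> T" for s t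
  proof -
    have "S t x = S s (S (t - s) x)" using C0_semigroupD(2)[OF S, of s "t - s" x] that by simp
    then have "norm (S t x - S s x) = norm (S s (S (t - s) x - x))" by (simp add: blinfun.bilinear_simps)
    also have "\<dots> \<le> norm (S s) * norm (S (t - s) x - x)" by (rule norm_blinfun)
    also have "\<dots> \<le> M * norm (S (t - s) x - x)" using M(2)[of s] that by (intro mult_right_mono) auto
    finally show ?thesis .
  qed
  show ?thesis
    unfolding continuous_on_iff
  proof (intro ballI allI impI)
    fix s e :: real assume s: "s \<in> {0..T}" and e: "e > 0"
    have "\<forall>\<^sub>F h in at_right 0. dist (S h x) x < e / M"
      using C0_semigroupD(3)[OF S, of x] e M(1) by (intro tendstoD) auto
    then obtain d where d: "d > 0" "\<And>h. 0 < h \<Longrightarrow> h < d \<Longrightarrow> norm (S h x - x) < e / M"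
      unfolding eventually_at_right_field by (auto simp: dist_norm)
    have close: "norm (S t x - S s x) < e" if "0 \<le> s" "s \<le> t" "t \<le> T" "t - s < d" for s t
    proof (cases "s = t")
      case False
      then have "norm (S (t - s) x - x) < e / M" using that by (intro d(2)) auto
      then have "M * norm (S (t - s) x - x) < e" using M(1) by (simp add: field_simps)
      then show ?thesis using le[OF that(1-3)] by simp
    qed (use e in simp)
    have "dist (S t x) (S s x) < e" if "t \<in> {0..T}" "dist t s < d" for t
    proof (cases "s \<le> t")
      case True
      then show ?thesis using close[of s t] s that by (auto simp: dist_norm)
    next
      case False
      then show ?thesis using close[of t s] s that by (auto simp: dist_norm norm_minus_commute)
    qed
    then show "\<exists>d>0. \<forall>t\<in>{0..T}. dist t s < d \<longrightarrow> dist (S t x) (S s x) < e" using d(1) by blast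
  qed
qed

lemma C0_semigroup_continuous_apply:
  fixes S :: "real \<Rightarrow> 'a::banach \<Rightarrow>\<^sub>L 'a"
  assumes S: "C0_semigroup S" and a: "continuous_on K a" "\<And>s. s \<in> K \<Longrightarrow> a s \<in> {0..T}"
    and f: "continuous_on K f"
  shows "continuous_on K (\<lambda>s. blinfun_apply (S (a s)) (f s))"
  unfolding continuous_on
proof
  fix r assume r: "r \<in> K"
  obtain M where M: "M \<ge> 1" "\<And>t. 0 \<le> t \<Longrightarrow> t \<le> T \<Longrightarrow> norm (S t) \<le> M"
    using C0_semigroup_bounded[OF S] by metis
  have "continuous_on K (\<lambda>s. blinfun_apply (S (a s)) (f r))"
    by (rule continuous_on_compose2[OF C0_semigroup_continuous[OF S, of T] a(1)]) (use a(2) in auto)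
  then have 1: "((\<lambda>s. blinfun_apply (S (a s)) (f r)) \<longlongrightarrow> blinfun_apply (S (a r)) (f r)) (at r within K)"
    using r by (auto simp: continuous_on)
  have "(f \<longlongrightarrow> f r) (at r within K)" using f r by (auto simp: continuous_on)
  then have "((\<lambda>s. M * norm (f s - f r)) \<longlongrightarrow> 0) (at r within K)"
    by (intro tendsto_mult_right_zero tendsto_norm_zero LIM_zero)
  moreover have "\<forall>\<^sub>F s in at r within K. norm (blinfun_apply (S (a s)) (f s - f r)) \<le> M * norm (f s - f r)"
    unfolding eventually_at_filter
    using a(2) M(2) by (intro always_eventually) (auto intro!: order_trans[OF norm_blinfun] mult_right_mono)
  ultimately have "((\<lambda>s. blinfun_apply (S (a s)) (f s - f r)) \<longlongrightarrow> 0) (at r within K)"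
    by (rule Lim_null_comparison[rotated])
  from tendsto_add[OF this 1]
  show "((\<lambda>s. blinfun_apply (S (a s)) (f s)) \<longlongrightarrow> blinfun_apply (S (a r)) (f r)) (at r within K)"
    by (simp add: blinfun.bilinear_simps)
qed

lemma has_vector_derivative_at_rightD:
  assumes "(f has_vector_derivative f') (at a within {a..b})" "a < b"
  shows "((\<lambda>h. (1 / h) *\<^sub>R (f (a + h) - f a)) \<longlongrightarrow> f') (at_right 0)"
proof -
  have "((\<lambda>y. (1 / norm (y - a)) *\<^sub>R (f y - (f a + (y - a) *\<^sub>R f'))) \<longlongrightarrow> 0) (at_right a)"
    using assms unfolding has_vector_derivative_def has_derivative_within
    by (simp add: at_within_Icc_at_right)
  moreover have "\<forall>\<^sub>F y in at_right a. (1 / norm (y - a)) *\<^sub>R (f y - (f a + (y - a) *\<^sub>R f'))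
      = (1 / (y - a)) *\<^sub>R (f y - f a) - f'"
    using eventually_at_right_less[of a]
    by eventually_elim (simp add: algebra_simps flip: scaleR_diff_left scaleR_add_left)
  ultimately have "((\<lambda>y. (1 / (y - a)) *\<^sub>R (f y - f a) - f') \<longlongrightarrow> 0) (at_right a)"
    by (rule Lim_transform_eventually)
  then have "((\<lambda>y. (1 / (y - a)) *\<^sub>R (f y - f a)) \<longlongrightarrow> f') (at_right a)"
    by (rule LIM_zero_cancel)
  then show ?thesis unfolding filterlim_at_right_to_0[of _ _ a] by (simp add: add.commute)
qed

text \<open>
  Applying the semigroup to the integral of an orbit shifts the interval of integration, so the
  difference quotient consists of averages over short intervals at its two ends. Hence such integrals
  lie in the domain of the generator; this is the source of the density of the domain.
\<close>

lemma integral_C0_semigroup_generator: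
  fixes S :: "real \<Rightarrow> 'a::banach \<Rightarrow>\<^sub>L 'a" and x :: 'a
  assumes S: "C0_semigroup S" and h: "h > 0"
  defines "u \<equiv> integral {0..h} (\<lambda>r. blinfun_apply (S r) x)"
  shows "((\<lambda>k. (1 / k) *\<^sub>R (S k u - u)) \<longlongrightarrow> S h x - x) (at_right 0)"
proof -
  define I where "I t = integral {0..t} (\<lambda>r. blinfun_apply (S r) x)" for t
  have cont: "continuous_on {0..t} (\<lambda>r. blinfun_apply (S r) x)" for t
    by (rule C0_semigroup_continuous[OF S])
  have int: "(\<lambda>r. blinfun_apply (S r) x) integrable_on {a..b}" if "0 \<le> a" for a b
    using that by (intro integrable_continuous_interval continuous_on_subset[OF cont[of b]]) auto
  have der: "((\<lambda>k. (1 / k) *\<^sub>R (I (a + k) - I a)) \<longlongrightarrow> S a x) (at_right 0)" if "0 \<le> a" for a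
  proof -
    have "(I has_vector_derivative S a x) (at a within {0..a + 1})"
      unfolding I_def using that by (intro integral_has_vector_derivative cont) auto
    then have "(I has_vector_derivative S a x) (at a within {a..a + 1})"
      using that by (elim has_vector_derivative_within_subset) auto
    then show ?thesis by (rule has_vector_derivative_at_rightD) simp
  qed
  have shift: "S k u - u = (I (h + k) - I h) - (I (0 + k) - I 0)" if k: "k > 0" for k
  proof -
    have "S k u = integral {0..h} (blinfun_apply (S k) \<circ> (\<lambda>r. S r x))"
      unfolding u_def using int by (intro integral_linear[symmetric] blinfun.bounded_linear_right) auto
    also have "\<dots> = integral {0..h} (\<lambda>r. S (r + k) x)"
      using k by (intro integral_cong) (simp add: C0_semigroupD(2)[OF S, symmetric] add.commute)
    also have "\<dots> = integral {k..h + k} (\<lambda>r. S r x)"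
      using integral_shift_Icc_real[of 0 h "\<lambda>r. blinfun_apply (S r) x" k] by (simp add: comp_def add.commute)
    also have "\<dots> = I (h + k) - I k"
      using Henstock_Kurzweil_Integration.integral_combine[of 0 k "h + k" "\<lambda>r. blinfun_apply (S r) x"] k h int
      by (simp add: I_def eq_diff_eq add.commute)
    finally show ?thesis by (simp add: u_def I_def)
  qed
  have "((\<lambda>k. (1 / k) *\<^sub>R (I (h + k) - I h) - (1 / k) *\<^sub>R (I (0 + k) - I 0)) \<longlongrightarrow> S h x - S 0 x) (at_right 0)"
    using h by (intro tendsto_diff der) auto
  then have "((\<lambda>k. (1 / k) *\<^sub>R (I (h + k) - I h) - (1 / k) *\<^sub>R (I (0 + k) - I 0)) \<longlongrightarrow> S h x - x) (at_right 0)"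
    using C0_semigroupD(1)[OF S] by simp
  moreover have "\<forall>\<^sub>F k in at_right 0. (1 / k) *\<^sub>R (I (h + k) - I h) - (1 / k) *\<^sub>R (I (0 + k) - I 0) = (1 / k) *\<^sub>R (S k u - u)"
    using eventually_at_right_less[of 0] by eventually_elim (simp only: shift scaleR_diff_right)
  ultimately show ?thesis by (rule Lim_transform_eventually)
qed

lemma generator_domain_dense:
  fixes S :: "real \<Rightarrow> 'a::banach \<Rightarrow>\<^sub>L 'a"
  assumes gen: "generates D A S"
  shows "x \<in> closure D"
proof -
  have S: "C0_semigroup S"
    and D: "\<And>y z. ((\<lambda>h. (1 / h) *\<^sub>R (S h y - y)) \<longlongrightarrow> z) (at_right 0) \<Longrightarrow> y \<in> D"
    using gen unfolding generates_def by auto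
  define I where "I t = integral {0..t} (\<lambda>r. blinfun_apply (S r) x)" for t
  have ID: "I h \<in> D" if "h > 0" for h
    unfolding I_def by (rule D[OF integral_C0_semigroup_generator[OF S that]])
  have mult: "a *\<^sub>R y \<in> D" if "y \<in> D" for a y
  proof -
    have "((\<lambda>h. (1 / h) *\<^sub>R (S h y - y)) \<longlongrightarrow> A y) (at_right 0)" using gen that unfolding generates_def by blast
    then have "((\<lambda>h. a *\<^sub>R ((1 / h) *\<^sub>R (S h y - y))) \<longlongrightarrow> a *\<^sub>R A y) (at_right 0)"
      by (intro tendsto_intros)
    then show ?thesis by (intro D[of _ "a *\<^sub>R A y"]) (simp add: blinfun.bilinear_simps algebra_simps)
  qed
  have "(I has_vector_derivative S 0 x) (at 0 within {0..1})"
    unfolding I_def by (intro integral_has_vector_derivative C0_semigroup_continuous[OF S]) auto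
  then have "((\<lambda>h. (1 / h) *\<^sub>R (I (0 + h) - I 0)) \<longlongrightarrow> S 0 x) (at_right 0)"
    by (rule has_vector_derivative_at_rightD) simp
  then have lim: "((\<lambda>h. (1 / h) *\<^sub>R I h) \<longlongrightarrow> x) (at_right 0)"
    using C0_semigroupD(1)[OF S] by (simp add: I_def)
  have "\<forall>\<^sub>F h in at_right 0. (1 / h) *\<^sub>R I h \<in> closure D"
    using eventually_at_right_less[of 0]
    by eventually_elim (use ID mult closure_subset in blast)
  then show ?thesis by (rule Lim_in_closed_set[OF closed_closure _ _ lim]) simp
qed

text \<open>
  Only right difference quotients are available for semigroups, so the mean value theorem is replaced
  by a largest time up to which the increment stays below \<open>e' * s\<close>.
\<close>

lemma right_derivative_zero_imp_constant:
  fixes g :: "real \<Rightarrow> 'a::real_normed_vector"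
  assumes cont: "continuous_on {0..t} g" and t: "t \<ge> 0"
    and der: "\<And>s. 0 \<le> s \<Longrightarrow> s < t \<Longrightarrow> ((\<lambda>h. (1 / h) *\<^sub>R (g (s + h) - g s)) \<longlongrightarrow> 0) (at_right 0)"
  shows "g t = g 0"
proof -
  have "norm (g t - g 0) \<le> 0 + e" if e: "e > 0" for e :: real
  proof -
    define e' where "e' = e / (t + 1)"
    have e': "e' > 0" "e' * t \<le> e" using e t by (auto simp: e'_def field_simps)
    define W where "W = {s \<in> {0..t}. norm (g s - g 0) \<le> e' * s}"
    have "continuous_on {0..t} (\<lambda>s. norm (g s - g 0) - e' * s)"
      using cont by (intro continuous_intros)
    then have "closed ({0..t} \<inter> (\<lambda>s. norm (g s - g 0) - e' * s) -` {..0})"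
      by (intro continuous_closed_preimage) auto
    moreover have "{0..t} \<inter> (\<lambda>s. norm (g s - g 0) - e' * s) -` {..0} = W" by (auto simp: W_def)
    ultimately have "closed W" by simp
    moreover have "W \<subseteq> {0..t}" by (auto simp: W_def)
    ultimately have "compact W" using bounded_subset[OF bounded_closed_interval] compact_eq_bounded_closed by blast
    moreover have "0 \<in> W" using t by (simp add: W_def)
    ultimately obtain s where s: "s \<in> W" "\<And>r. r \<in> W \<Longrightarrow> r \<le> s"
      using compact_attains_sup[of W] by blast
    have s0: "0 \<le> s" "s \<le> t" "norm (g s - g 0) \<le> e' * s" using s(1) by (auto simp: W_def)
    have "s = t"
    proof (rule ccontr)
      assume "s \<noteq> t"
      then have st: "s < t" using s0 by simp
      have "\<forall>\<^sub>F h in at_right 0. dist ((1 / h) *\<^sub>R (g (s + h) - g s)) 0 < e'"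
        using der[OF s0(1) st] e'(1) by (rule tendstoD)
      moreover have "\<forall>\<^sub>F h in at_right 0. h \<in> {0<..<t - s}"
        using st by (intro eventually_at_right_real) simp
      ultimately have "\<forall>\<^sub>F h in at_right (0::real). s + h \<in> W \<and> h > 0"
      proof eventually_elim
        case (elim h)
        have "norm ((1 / h) *\<^sub>R (g (s + h) - g s)) = norm (g (s + h) - g s) / h" using elim(2) by simp
        then have "norm (g (s + h) - g s) < e' * h" using elim by (simp add: pos_divide_less_eq)
        then have "norm (g (s + h) - g 0) \<le> e' * (s + h)"
          using norm_triangle_ineq[of "g (s + h) - g s" "g s - g 0"] s0(3) by (simp add: algebra_simps)
        then show ?case using elim(2) s0(1) by (simp add: W_def)
      qed
      then obtain h where "s + h \<in> W" "h > 0"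
        using eventually_happens'[OF trivial_limit_at_right_real] by blast
      then show False using s(2)[of "s + h"] by simp
    qed
    then show ?thesis using s0(3) e'(2) by simp
  qed
  then have "norm (g t - g 0) \<le> 0" by (rule field_le_epsilon)
  then show ?thesis by simp
qed

text \<open>
  On the domain, \<open>s \<mapsto> R (t - s) (S s x)\<close> has right derivative zero: the difference
  quotient at \<open>s\<close> applies a bounded operator to the difference of the two difference quotients at
  \<open>S s x\<close>, both of which tend to the same value of the generator. Its values at \<open>0\<close> and
  \<open>t\<close> are \<open>R t x\<close> and \<open>S t x\<close>. Density of the domain finishes the proof.
\<close>

theorem generates_unique:
  fixes S R :: "real \<Rightarrow> 'a::banach \<Rightarrow>\<^sub>L 'a"
  assumes genS: "generates D A S" and genR: "generates D A R" and t: "t \<ge> 0"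
  shows "S t = R t"
proof -
  have S: "C0_semigroup S" and R: "C0_semigroup R"
    using genS genR unfolding generates_def by auto
  obtain M where M: "M \<ge> 1" "\<And>s. 0 \<le> s \<Longrightarrow> s \<le> t \<Longrightarrow> norm (R s) \<le> M"
    using C0_semigroup_bounded[OF R] by metis
  have eqD: "S t x = R t x" if x: "x \<in> D" for x
  proof -
    define g where "g s = R (t - s) (S s x)" for s
    have SD: "S s x \<in> D" if s: "s \<ge> 0" for s
    proof -
      have "((\<lambda>h. (1 / h) *\<^sub>R (S h x - x)) \<longlongrightarrow> A x) (at_right 0)" using genS x unfolding generates_def by blast
      then have "((\<lambda>h. S s ((1 / h) *\<^sub>R (S h x - x))) \<longlongrightarrow> S s (A x)) (at_right 0)"
        by (intro tendsto_intros)
      moreover have "\<forall>\<^sub>F h in at_right 0. S s ((1 / h) *\<^sub>R (S h x - x)) = (1 / h) *\<^sub>R (S h (S s x) - S s x)"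
        using eventually_at_right_less[of 0]
      proof eventually_elim
        case (elim h)
        then have "S s (S h x) = S h (S s x)" using C0_semigroupD(2)[OF S] s by (metis add.commute less_imp_le)
        then show ?case by (simp add: blinfun.bilinear_simps)
      qed
      ultimately have "((\<lambda>h. (1 / h) *\<^sub>R (S h (S s x) - S s x)) \<longlongrightarrow> S s (A x)) (at_right 0)"
        by (rule Lim_transform_eventually)
      then show ?thesis using genS unfolding generates_def by blast
    qed
    have cont: "continuous_on {0..t} g"
      unfolding g_def
      by (rule C0_semigroup_continuous_apply[OF R, where T = t])
        (auto intro!: continuous_intros C0_semigroup_continuous[OF S])
    have "g t = g 0"
    proof (rule right_derivative_zero_imp_constant[OF cont t])
      fix s assume s: "0 \<le> s" "s < t"
      define y where "y = S s x"
      have y: "y \<in> D" unfolding y_def using s by (intro SD)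
      have "((\<lambda>h. (1 / h) *\<^sub>R (S h y - y) - (1 / h) *\<^sub>R (R h y - y)) \<longlongrightarrow> A y - A y) (at_right 0)"
        using genS genR y unfolding generates_def by (intro tendsto_diff) blast+
      then have lim: "((\<lambda>h. M * norm ((1 / h) *\<^sub>R (S h y - y) - (1 / h) *\<^sub>R (R h y - y))) \<longlongrightarrow> 0) (at_right 0)"
        by (intro tendsto_mult_right_zero tendsto_norm_zero) simp
      have ev: "\<forall>\<^sub>F h in at_right 0. h \<in> {0<..<t - s}"
        using s by (intro eventually_at_right_real) simp
      show "((\<lambda>h. (1 / h) *\<^sub>R (g (s + h) - g s)) \<longlongrightarrow> 0) (at_right 0)"
      proof (rule Lim_null_comparison[OF _ lim])
        show "\<forall>\<^sub>F h in at_right 0. norm ((1 / h) *\<^sub>R (g (s + h) - g s))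
            \<le> M * norm ((1 / h) *\<^sub>R (S h y - y) - (1 / h) *\<^sub>R (R h y - y))"
          using ev
        proof eventually_elim
          case (elim h)
          let ?r = "t - (s + h)"
          have 1: "S (s + h) x = S h y"
            unfolding y_def using C0_semigroupD(2)[OF S, of h s x] elim s by (simp add: add.commute)
          have 2: "R (t - s) y = R ?r (R h y)" using C0_semigroupD(2)[OF R, of ?r h y] elim by simp
          have "(1 / h) *\<^sub>R (g (s + h) - g s) = R ?r ((1 / h) *\<^sub>R (S h y - y) - (1 / h) *\<^sub>R (R h y - y))"
            unfolding g_def 1 y_def[symmetric] 2 by (simp add: blinfun.bilinear_simps algebra_simps)
          also have "norm \<dots> \<le> norm (R ?r) * norm ((1 / h) *\<^sub>R (S h y - y) - (1 / h) *\<^sub>R (R h y - y))"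
            by (rule norm_blinfun)
          also have "\<dots> \<le> M * norm ((1 / h) *\<^sub>R (S h y - y) - (1 / h) *\<^sub>R (R h y - y))"
            using elim s by (intro mult_right_mono M(2)) auto
          finally show ?case .
        qed
      qed
    qed
    then show ?thesis using C0_semigroupD(1)[OF S] C0_semigroupD(1)[OF R] by (simp add: g_def)
  qed
  have "S t x = R t x" for x
  proof -
    have "closed {x. S t x = R t x}" by (intro closed_Collect_eq continuous_intros)
    moreover have "D \<subseteq> {x. S t x = R t x}" using eqD by auto
    ultimately have "closure D \<subseteq> {x. S t x = R t x}" by (rule closure_minimal[rotated])
    then show ?thesis using generator_domain_dense[OF genS] by blast
  qed
  then show ?thesis by (rule blinfun_eqI)
qed

section \<open>The Bochner integral over a complete measure\<close>

text \<open>
  Strong measurability is an almost everywhere statement; completeness turns it into Borel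
  measurability of norms, which the additivity of the upper integral requires.
\<close>

lemma complete_measure_lebesgue_on:
  assumes "S \<in> sets lebesgue"
  shows "complete_measure (lebesgue_on S)"
proof
  fix A B assume "B \<subseteq> A" "A \<in> null_sets (lebesgue_on S)"
  then have A: "A \<subseteq> S" "A \<in> null_sets lebesgue"
    using assms by (auto simp: null_sets_restrict_space)
  then have "B \<in> sets lebesgue" using \<open>B \<subseteq> A\<close> completion.complete2 by blast
  then show "B \<in> sets (lebesgue_on S)"
    using assms A(1) \<open>B \<subseteq> A\<close> by (auto simp: sets_restrict_space_iff)
qed

lemma (in complete_measure) borel_measurable_AE_LIMSEQ:
  fixes f :: "'a \<Rightarrow> real"
  assumes u: "\<And>i::nat. u i \<in> borel_measurable M" and lim: "AE x in M. (\<lambda>i. u i x) \<longlonglongrightarrow> f x"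
  shows "f \<in> borel_measurable M"
proof -
  define N where "N = {x \<in> space M. \<not> (\<lambda>i. u i x) \<longlonglongrightarrow> f x}"
  have N: "N \<in> null_sets M" using lim unfolding N_def by (simp add: AE_iff_null_sets)
  then have [measurable]: "N \<in> sets M" by auto
  define g where "g x = (if x \<in> N then 0 else f x)" for x
  have g: "g \<in> borel_measurable M"
  proof (rule borel_measurable_LIMSEQ_real)
    show "(\<lambda>i. if x \<in> N then 0 else u i x) \<longlonglongrightarrow> g x" if "x \<in> space M" for x
      using that by (auto simp: g_def N_def)
    show "(\<lambda>x. if x \<in> N then 0 else u i x) \<in> borel_measurable M" for i
      using u[of i] by measurable
  qed
  show ?thesis
  proof (rule measurableI)
    fix A :: "real set" assume A: "A \<in> sets borel"
    have "AE x in M. x \<notin> N" using N by (rule AE_not_in)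
    then have "AE x in M. x \<in> g -` A \<inter> space M \<longleftrightarrow> x \<in> f -` A \<inter> space M"
      by eventually_elim (simp add: g_def)
    then show "f -` A \<inter> space M \<in> sets M"
      by (rule in_sets_AE) (use g A in \<open>auto intro: measurable_sets\<close>)
  qed simp
qed

lemma (in complete_measure) borel_measurable_norm_diff_simple:
  assumes f: "strongly_measurable M f" and s: "simple_function M s"
  shows "(\<lambda>x. norm (f x - s x)) \<in> borel_measurable M"
proof -
  obtain u where u: "\<And>i::nat. simple_function M (u i)" "AE x in M. (\<lambda>i. u i x) \<longlonglongrightarrow> f x"
    using f unfolding strongly_measurable_def by blast
  show ?thesis
  proof (rule borel_measurable_AE_LIMSEQ)
    show "(\<lambda>x. norm (u i x - s x)) \<in> borel_measurable M" for i
      by (intro borel_measurable_simple_function simple_function_compose2[OF u(1) s])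
    show "AE x in M. (\<lambda>i. norm (u i x - s x)) \<longlonglongrightarrow> norm (f x - s x)"
      using u(2) by eventually_elim (intro tendsto_intros)
  qed
qed

lemma (in complete_measure) bochner_integral_is_add:
  assumes f: "bochner_integral_is M f v" and g: "bochner_integral_is M g w"
  shows "bochner_integral_is M (\<lambda>x. f x + g x) (v + w)"
proof -
  have fm: "strongly_measurable M f" and gm: "strongly_measurable M g"
    using f g unfolding bochner_integral_is_def by auto
  obtain s where s: "\<And>i::nat. Bochner_Integration.simple_bochner_integrable M (s i)"
    "(\<lambda>i. \<integral>\<^sup>+x. ennreal (norm (f x - s i x)) \<partial>M) \<longlonglongrightarrow> 0"
    "(\<lambda>i. Bochner_Integration.simple_bochner_integral M (s i)) \<longlonglongrightarrow> v"
    using f unfolding bochner_integral_is_def by blast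
  obtain r where r: "\<And>i::nat. Bochner_Integration.simple_bochner_integrable M (r i)"
    "(\<lambda>i. \<integral>\<^sup>+x. ennreal (norm (g x - r i x)) \<partial>M) \<longlonglongrightarrow> 0"
    "(\<lambda>i. Bochner_Integration.simple_bochner_integral M (r i)) \<longlonglongrightarrow> w"
    using g unfolding bochner_integral_is_def by blast
  have sm: "simple_function M (s i)" "simple_function M (r i)" for i
    using s(1)[of i] r(1)[of i] by (auto elim: Bochner_Integration.simple_bochner_integrable.cases)
  obtain a where a: "\<And>i::nat. simple_function M (a i)" "AE x in M. (\<lambda>i. a i x) \<longlonglongrightarrow> f x"
    using fm unfolding strongly_measurable_def by blast
  obtain b where b: "\<And>i::nat. simple_function M (b i)" "AE x in M. (\<lambda>i. b i x) \<longlonglongrightarrow> g x"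
    using gm unfolding strongly_measurable_def by blast
  show ?thesis
    unfolding bochner_integral_is_def
  proof (intro conjI)
    show "strongly_measurable M (\<lambda>x. f x + g x)"
      unfolding strongly_measurable_def
    proof (intro exI[of _ "\<lambda>i x. a i x + b i x"] conjI allI)
      show "AE x in M. (\<lambda>i. a i x + b i x) \<longlonglongrightarrow> f x + g x"
        using a(2) b(2) by eventually_elim (rule tendsto_add)
    qed (rule simple_function_compose2[OF a(1) b(1)])
    show "\<exists>s. (\<forall>i::nat. Bochner_Integration.simple_bochner_integrable M (s i)) \<and>
          (\<lambda>i. \<integral>\<^sup>+x. ennreal (norm (f x + g x - s i x)) \<partial>M) \<longlonglongrightarrow> 0 \<and>
          (\<lambda>i. Bochner_Integration.simple_bochner_integral M (s i)) \<longlonglongrightarrow> v + w"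
    proof (intro exI[of _ "\<lambda>i x. s i x + r i x"] conjI allI)
      show "Bochner_Integration.simple_bochner_integrable M (\<lambda>x. s i x + r i x)" for i
        by (rule simple_bochner_integrable_compose2[OF _ s(1) r(1)]) simp
      show "(\<lambda>i. Bochner_Integration.simple_bochner_integral M (\<lambda>x. s i x + r i x)) \<longlonglongrightarrow> v + w"
        unfolding simple_bochner_integral_add[OF s(1) r(1)] by (intro tendsto_add s(3) r(3))
      have le: "(\<integral>\<^sup>+x. ennreal (norm (f x + g x - (s i x + r i x))) \<partial>M)
          \<le> (\<integral>\<^sup>+x. ennreal (norm (f x - s i x)) \<partial>M) + (\<integral>\<^sup>+x. ennreal (norm (g x - r i x)) \<partial>M)" for i
      proof -
        have "(\<integral>\<^sup>+x. ennreal (norm (f x + g x - (s i x + r i x))) \<partial>M)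
            \<le> (\<integral>\<^sup>+x. ennreal (norm (f x - s i x)) + ennreal (norm (g x - r i x)) \<partial>M)"
          by (intro nn_integral_mono)
            (auto simp: norm_diff_triangle_ineq simp flip: ennreal_plus intro!: ennreal_leI)
        also have "\<dots> = (\<integral>\<^sup>+x. ennreal (norm (f x - s i x)) \<partial>M) + (\<integral>\<^sup>+x. ennreal (norm (g x - r i x)) \<partial>M)"
          using borel_measurable_norm_diff_simple[OF fm sm(1)] borel_measurable_norm_diff_simple[OF gm sm(2)]
          by (intro nn_integral_add) auto
        finally show ?thesis .
      qed
      show "(\<lambda>i. \<integral>\<^sup>+x. ennreal (norm (f x + g x - (s i x + r i x))) \<partial>M) \<longlonglongrightarrow> 0"
        by (rule tendsto_sandwich[OF _ _ tendsto_const tendsto_add[OF s(2) r(2), simplified]])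
          (auto simp: le)
    qed
  qed
qed

lemma (in complete_measure) bochner_integral_is_scaleR:
  assumes f: "bochner_integral_is M f v"
  shows "bochner_integral_is M (\<lambda>x. c *\<^sub>R f x) (c *\<^sub>R v)"
proof -
  have fm: "strongly_measurable M f" using f unfolding bochner_integral_is_def by auto
  obtain s where s: "\<And>i::nat. Bochner_Integration.simple_bochner_integrable M (s i)"
    "(\<lambda>i. \<integral>\<^sup>+x. ennreal (norm (f x - s i x)) \<partial>M) \<longlonglongrightarrow> 0"
    "(\<lambda>i. Bochner_Integration.simple_bochner_integral M (s i)) \<longlonglongrightarrow> v"
    using f unfolding bochner_integral_is_def by blast
  have sm: "simple_function M (s i)" for i
    using s(1)[of i] by (auto elim: Bochner_Integration.simple_bochner_integrable.cases)
  obtain a where a: "\<And>i::nat. simple_function M (a i)" "AE x in M. (\<lambda>i. a i x) \<longlonglongrightarrow> f x"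
    using fm unfolding strongly_measurable_def by blast
  show ?thesis
    unfolding bochner_integral_is_def
  proof (intro conjI)
    show "strongly_measurable M (\<lambda>x. c *\<^sub>R f x)"
      unfolding strongly_measurable_def
    proof (intro exI[of _ "\<lambda>i x. c *\<^sub>R a i x"] conjI allI)
      show "AE x in M. (\<lambda>i. c *\<^sub>R a i x) \<longlonglongrightarrow> c *\<^sub>R f x"
        using a(2) by eventually_elim (intro tendsto_intros)
    qed (rule simple_function_compose1[OF a(1)])
    show "\<exists>s. (\<forall>i::nat. Bochner_Integration.simple_bochner_integrable M (s i)) \<and>
          (\<lambda>i. \<integral>\<^sup>+x. ennreal (norm (c *\<^sub>R f x - s i x)) \<partial>M) \<longlonglongrightarrow> 0 \<and>
          (\<lambda>i. Bochner_Integration.simple_bochner_integral M (s i)) \<longlonglongrightarrow> c *\<^sub>R v"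
    proof (intro exI[of _ "\<lambda>i x. c *\<^sub>R s i x"] conjI allI)
      show "Bochner_Integration.simple_bochner_integrable M (\<lambda>x. c *\<^sub>R s i x)" for i
        by (rule simple_bochner_integrable_compose2[OF _ s(1) s(1), of "\<lambda>x y. c *\<^sub>R x"]) simp
      have "Bochner_Integration.simple_bochner_integral M (\<lambda>x. c *\<^sub>R s i x)
          = c *\<^sub>R Bochner_Integration.simple_bochner_integral M (s i)" for i
        by (rule simple_bochner_integral_linear[OF bounded_linear.linear[OF bounded_linear_scaleR_right] s(1)])
      then show "(\<lambda>i. Bochner_Integration.simple_bochner_integral M (\<lambda>x. c *\<^sub>R s i x)) \<longlonglongrightarrow> c *\<^sub>R v"
        using s(3) by (simp add: tendsto_scaleR)
      have "(\<integral>\<^sup>+x. ennreal (norm (c *\<^sub>R f x - c *\<^sub>R s i x)) \<partial>M)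
          = ennreal \<bar>c\<bar> * (\<integral>\<^sup>+x. ennreal (norm (f x - s i x)) \<partial>M)" for i
        using borel_measurable_norm_diff_simple[OF fm sm]
        by (subst nn_integral_cmult[symmetric])
          (auto simp flip: scaleR_diff_right ennreal_mult)
      then show "(\<lambda>i. \<integral>\<^sup>+x. ennreal (norm (c *\<^sub>R f x - c *\<^sub>R s i x)) \<partial>M) \<longlonglongrightarrow> 0"
        using ennreal_tendsto_cmult[OF _ s(2), of "ennreal \<bar>c\<bar>"] by simp
    qed
  qed
qed

lemma bochner_integral_is_zero: "bochner_integral_is M (\<lambda>x. 0 :: 'b::real_normed_vector) 0"
proof -
  have "Bochner_Integration.simple_bochner_integral M (\<lambda>x. 0 :: 'b) = 0"
    unfolding Bochner_Integration.simple_bochner_integral_def by (rule sum.neutral) auto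
  moreover have "Bochner_Integration.simple_bochner_integrable M (\<lambda>x. 0 :: 'b)"
    by (auto intro: Bochner_Integration.simple_bochner_integrable.intros)
  ultimately show ?thesis
    unfolding bochner_integral_is_def strongly_measurable_def
    by (auto intro!: exI[of _ "\<lambda>i x. 0"])
qed

lemma bochner_integral_is_cong:
  assumes f: "bochner_integral_is M f v" and eq: "\<And>x. x \<in> space M \<Longrightarrow> f x = g x"
  shows "bochner_integral_is M g v"
proof -
  have 1: "(\<integral>\<^sup>+x. ennreal (norm (g x - s x)) \<partial>M) = (\<integral>\<^sup>+x. ennreal (norm (f x - s x)) \<partial>M)" for s
    using eq by (intro nn_integral_cong) simp
  have 2: "(AE x in M. (\<lambda>i. s i x) \<longlonglongrightarrow> g x) \<longleftrightarrow> (AE x in M. (\<lambda>i. s i x) \<longlonglongrightarrow> f x)" for s :: "nat \<Rightarrow> _"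
    using eq by (intro AE_cong) simp
  show ?thesis
    using f unfolding bochner_integral_is_def strongly_measurable_def 1 2 .
qed

lemma (in complete_measure) norm_bochner_integral_is_le:
  assumes f: "bochner_integral_is M f v" and g: "g \<in> borel_measurable M"
    and le: "AE x in M. ennreal (norm (f x)) \<le> g x"
  shows "ennreal (norm v) \<le> (\<integral>\<^sup>+x. g x \<partial>M)"
proof -
  have fm: "strongly_measurable M f" using f unfolding bochner_integral_is_def by auto
  obtain s where s: "\<And>i::nat. Bochner_Integration.simple_bochner_integrable M (s i)"
    "(\<lambda>i. \<integral>\<^sup>+x. ennreal (norm (f x - s i x)) \<partial>M) \<longlonglongrightarrow> 0"
    "(\<lambda>i. Bochner_Integration.simple_bochner_integral M (s i)) \<longlonglongrightarrow> v"
    using f unfolding bochner_integral_is_def by blast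
  have sm: "simple_function M (s i)" for i
    using s(1)[of i] by (auto elim: Bochner_Integration.simple_bochner_integrable.cases)
  have "ennreal (norm (Bochner_Integration.simple_bochner_integral M (s i)))
      \<le> (\<integral>\<^sup>+x. g x \<partial>M) + (\<integral>\<^sup>+x. ennreal (norm (f x - s i x)) \<partial>M)" for i
  proof -
    have nm: "Bochner_Integration.simple_bochner_integrable M (\<lambda>x. norm (s i x))"
      by (rule simple_bochner_integrable_compose2[OF _ s(1) s(1), of "\<lambda>x y. norm x"]) simp
    have "ennreal (norm (Bochner_Integration.simple_bochner_integral M (s i)))
        \<le> ennreal (Bochner_Integration.simple_bochner_integral M (\<lambda>x. norm (s i x)))"
      by (intro ennreal_leI simple_bochner_integral_norm_bound s(1))
    also have "\<dots> = (\<integral>\<^sup>+x. ennreal (norm (s i x)) \<partial>M)"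
      by (rule simple_bochner_integral_eq_nn_integral[OF nm]) simp
    also have "\<dots> \<le> (\<integral>\<^sup>+x. g x + ennreal (norm (f x - s i x)) \<partial>M)"
    proof (rule nn_integral_mono_AE)
      show "AE x in M. ennreal (norm (s i x)) \<le> g x + ennreal (norm (f x - s i x))"
        using le
      proof eventually_elim
        case (elim x)
        have "ennreal (norm (s i x)) \<le> ennreal (norm (f x)) + ennreal (norm (f x - s i x))"
          using norm_triangle_ineq4[of "f x" "f x - s i x"]
          by (simp add: ennreal_leI flip: ennreal_plus)
        also have "\<dots> \<le> g x + ennreal (norm (f x - s i x))" using elim by (intro add_right_mono)
        finally show ?case .
      qed
    qed
    also have "\<dots> = (\<integral>\<^sup>+x. g x \<partial>M) + (\<integral>\<^sup>+x. ennreal (norm (f x - s i x)) \<partial>M)"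
      using borel_measurable_norm_diff_simple[OF fm sm] g by (intro nn_integral_add) auto
    finally show ?thesis .
  qed
  then have le: "\<exists>N. \<forall>i\<ge>N. ennreal (norm (Bochner_Integration.simple_bochner_integral M (s i)))
      \<le> (\<integral>\<^sup>+x. g x \<partial>M) + (\<integral>\<^sup>+x. ennreal (norm (f x - s i x)) \<partial>M)" by blast
  have lim1: "(\<lambda>i. ennreal (norm (Bochner_Integration.simple_bochner_integral M (s i)))) \<longlonglongrightarrow> ennreal (norm v)"
    by (intro tendsto_ennrealI tendsto_norm s(3))
  have lim2: "(\<lambda>i. (\<integral>\<^sup>+x. g x \<partial>M) + (\<integral>\<^sup>+x. ennreal (norm (f x - s i x)) \<partial>M)) \<longlonglongrightarrow> (\<integral>\<^sup>+x. g x \<partial>M) + 0"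
    by (intro tendsto_add tendsto_const s(2))
  show ?thesis using LIMSEQ_le[OF lim1 lim2 le] by simp
qed

section \<open>Mild solutions\<close>

text \<open>
  With the semigroup fixed, linear combinations of solutions are solutions; since a generator
  determines its semigroup, the two notions of mild solution agree.
\<close>

definition mild_solution_for ::
  "(real \<Rightarrow> 'a::real_normed_vector \<Rightarrow>\<^sub>L 'a) \<Rightarrow> real \<Rightarrow> (real \<Rightarrow> 'a \<Rightarrow> 'a) \<Rightarrow> 'a \<Rightarrow> (real \<Rightarrow> 'a) \<Rightarrow> bool" where
  "mild_solution_for S T P \<phi>T \<phi> \<longleftrightarrow> continuous_on {0..T} \<phi> \<and>
     (\<forall>t\<in>{0..T}. bochner_integral_is (lebesgue_on {t..T})
        (\<lambda>s. blinfun_apply (S (s - t)) (P s (\<phi> s))) (\<phi> t - blinfun_apply (S (T - t)) \<phi>T))"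

lemma backward_mild_solution_iff:
  fixes S :: "real \<Rightarrow> 'a::banach \<Rightarrow>\<^sub>L 'a"
  assumes S: "generates D A S"
  shows "backward_mild_solution T D A P \<phi>T \<phi> \<longleftrightarrow> mild_solution_for S T P \<phi>T \<phi>"
proof
  assume "mild_solution_for S T P \<phi>T \<phi>"
  then show "backward_mild_solution T D A P \<phi>T \<phi>"
    using S unfolding mild_solution_for_def backward_mild_solution_def by blast
next
  assume "backward_mild_solution T D A P \<phi>T \<phi>"
  then obtain R where cont: "continuous_on {0..T} \<phi>" and R: "generates D A R"
    and sol: "\<And>t. t \<in> {0..T} \<Longrightarrow> bochner_integral_is (lebesgue_on {t..T})
        (\<lambda>s. blinfun_apply (R (s - t)) (P s (\<phi> s))) (\<phi> t - blinfun_apply (R (T - t)) \<phi>T)"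
    unfolding backward_mild_solution_def by blast
  have eq: "R r = S r" if "r \<ge> 0" for r by (rule generates_unique[OF R S that])
  have "bochner_integral_is (lebesgue_on {t..T})
        (\<lambda>s. blinfun_apply (S (s - t)) (P s (\<phi> s))) (\<phi> t - blinfun_apply (S (T - t)) \<phi>T)"
    if t: "t \<in> {0..T}" for t
  proof -
    have "R (T - t) = S (T - t)" using t by (intro eq) simp
    moreover have "R (s - t) = S (s - t)" if "s \<in> space (lebesgue_on {t..T})" for s
      using that by (intro eq) simp
    ultimately show ?thesis using bochner_integral_is_cong[OF sol[OF t]] by simp
  qed
  then show "mild_solution_for S T P \<phi>T \<phi>" using cont unfolding mild_solution_for_def by blast
qed

lemma mild_solution_for_zero:
  assumes "\<And>s. P s 0 = 0"
  shows "mild_solution_for S T P 0 (\<lambda>t. 0)"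
  unfolding mild_solution_for_def using assms
  by (simp add: blinfun.bilinear_simps bochner_integral_is_zero)

lemma mild_solution_for_add:
  assumes P: "\<And>s x y. P s (x + y) = P s x + P s y"
    and \<phi>: "mild_solution_for S T P x \<phi>" and \<psi>: "mild_solution_for S T P y \<psi>"
  shows "mild_solution_for S T P (x + y) (\<lambda>t. \<phi> t + \<psi> t)"
  unfolding mild_solution_for_def
proof (intro conjI ballI)
  show "continuous_on {0..T} (\<lambda>t. \<phi> t + \<psi> t)"
    using \<phi> \<psi> unfolding mild_solution_for_def by (intro continuous_on_add) auto
  fix t assume t: "t \<in> {0..T}"
  have "complete_measure (lebesgue_on {t..T})" by (rule complete_measure_lebesgue_on) simp
  then have "bochner_integral_is (lebesgue_on {t..T})
      (\<lambda>s. blinfun_apply (S (s - t)) (P s (\<phi> s)) + blinfun_apply (S (s - t)) (P s (\<psi> s)))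
      ((\<phi> t - blinfun_apply (S (T - t)) x) + (\<psi> t - blinfun_apply (S (T - t)) y))"
    using \<phi> \<psi> t unfolding mild_solution_for_def
    by (intro complete_measure.bochner_integral_is_add) auto
  moreover have "(\<phi> t - blinfun_apply (S (T - t)) x) + (\<psi> t - blinfun_apply (S (T - t)) y)
      = \<phi> t + \<psi> t - blinfun_apply (S (T - t)) (x + y)"
    by (simp add: blinfun.bilinear_simps)
  ultimately show "bochner_integral_is (lebesgue_on {t..T})
      (\<lambda>s. blinfun_apply (S (s - t)) (P s (\<phi> s + \<psi> s)))
      (\<phi> t + \<psi> t - blinfun_apply (S (T - t)) (x + y))"
    by (simp only: P blinfun.add_right)
qed

lemma mild_solution_for_scaleR:
  assumes P: "\<And>s a x. P s (a *\<^sub>R x) = a *\<^sub>R P s x"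
    and \<phi>: "mild_solution_for S T P x \<phi>"
  shows "mild_solution_for S T P (a *\<^sub>R x) (\<lambda>t. a *\<^sub>R \<phi> t)"
  unfolding mild_solution_for_def
proof (intro conjI ballI)
  show "continuous_on {0..T} (\<lambda>t. a *\<^sub>R \<phi> t)"
    using \<phi> unfolding mild_solution_for_def by (intro continuous_intros) auto
  fix t assume t: "t \<in> {0..T}"
  have "complete_measure (lebesgue_on {t..T})" by (rule complete_measure_lebesgue_on) simp
  from complete_measure.bochner_integral_is_scaleR[OF this] \<phi> t
  show "bochner_integral_is (lebesgue_on {t..T})
      (\<lambda>s. blinfun_apply (S (s - t)) (P s (a *\<^sub>R \<phi> s)))
      (a *\<^sub>R \<phi> t - blinfun_apply (S (T - t)) (a *\<^sub>R x))"
    unfolding mild_solution_for_def P blinfun.scaleR_right scaleR_diff_right[symmetric] by blast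
qed

lemma nn_integral_exp_decay:
  assumes c: "c \<ge> 0" and l: "l > 0" and t: "t \<le> T"
  shows "(\<integral>\<^sup>+s. ennreal (c * exp (l * (T - s))) \<partial>lebesgue_on {t..T}) \<le> ennreal (c / l * exp (l * (T - t)))"
proof -
  have "(\<integral>\<^sup>+s. ennreal (c * exp (l * (T - s))) \<partial>lebesgue_on {t..T})
      = (\<integral>\<^sup>+s. ennreal (c * exp (l * (T - s))) * indicator {t..T} s \<partial>lborel)"
    by (subst nn_integral_restrict_space) (auto simp: nn_integral_completion)
  also have "\<dots> = ennreal ((- c / l * exp (l * (T - T))) - (- c / l * exp (l * (T - t))))"
  proof (rule nn_integral_FTC_Icc)
    show "((\<lambda>s. - c / l * exp (l * (T - s))) has_real_derivative c * exp (l * (T - s))) (at s)" for s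
      using l by (auto intro!: derivative_eq_intros)
  qed (use c t in auto)
  also have "\<dots> \<le> ennreal (c / l * exp (l * (T - t)))" using c l by (intro ennreal_leI) simp
  finally show ?thesis .
qed

text \<open>
  Gronwall's inequality in the form of a weighted supremum norm: with weight \<open>exp (- l * (T - t))\<close>
  and \<open>l > 2 * M * K\<close>, the integral term contributes at most half of the weighted supremum
  \<open>w r\<close> and can be absorbed.
\<close>

lemma mild_solution_for_bound:
  fixes S :: "real \<Rightarrow> 'a::banach \<Rightarrow>\<^sub>L 'a"
  assumes S: "C0_semigroup S" and T: "T > 0" and K: "K \<ge> 0"
    and P: "AE s in lebesgue_on {0<..<T}. \<forall>x. norm (P s x) \<le> K * norm x"
  obtains M where "M \<ge> 0"
    "\<And>\<phi>T \<phi> t. mild_solution_for S T P \<phi>T \<phi> \<Longrightarrow> t \<in> {0..T} \<Longrightarrow> norm (\<phi> t) \<le> M * norm \<phi>T"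
proof -
  obtain M where M: "M \<ge> 1" "\<And>t. 0 \<le> t \<Longrightarrow> t \<le> T \<Longrightarrow> norm (S t) \<le> M"
    using C0_semigroup_bounded[OF S] by metis
  define l where "l = 2 * (M * K) + 1"
  have MK: "M * K \<ge> 0" using M(1) K by simp
  then have l: "l > 0" "M * K / l \<le> 1 / 2" by (auto simp: l_def field_simps)
  have "norm (\<phi> t) \<le> 2 * M * exp (l * T) * norm \<phi>T"
    if \<phi>: "mild_solution_for S T P \<phi>T \<phi>" and t: "t \<in> {0..T}" for \<phi>T \<phi> t
  proof -
    define w where "w s = exp (- l * (T - s)) * norm (\<phi> s)" for s
    have "continuous_on {0..T} w"
      using \<phi> unfolding w_def mild_solution_for_def by (intro continuous_intros) auto
    then obtain r where r: "r \<in> {0..T}" "\<And>s. s \<in> {0..T} \<Longrightarrow> w s \<le> w r"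
      using continuous_attains_sup[of "{0..T}" w] T by auto
    have \<phi>w: "norm (\<phi> s) \<le> w r * exp (l * (T - s))" if "s \<in> {0..T}" for s
    proof -
      have "norm (\<phi> s) = w s * exp (l * (T - s))" by (simp add: w_def mult_exp_exp flip: exp_add)
      also have "\<dots> \<le> w r * exp (l * (T - s))" using r(2)[OF that] by (intro mult_right_mono) auto
      finally show ?thesis .
    qed
    have w0: "w r \<ge> 0" by (simp add: w_def)
    define v where "v = \<phi> r - S (T - r) \<phi>T"
    have int: "bochner_integral_is (lebesgue_on {r..T}) (\<lambda>s. blinfun_apply (S (s - r)) (P s (\<phi> s))) v"
      using \<phi> r(1) unfolding mild_solution_for_def v_def by blast
    \<comment> \<open>the bound on P holds on the open interval; its endpoints are null sets, so it also holds almost everywhere on the closed interval\<close>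
    have "AE s in lebesgue. s \<in> {0<..<T} \<longrightarrow> (\<forall>x. norm (P s x) \<le> K * norm x)"
      using P by (subst (asm) AE_restrict_space_iff) auto
    moreover have "AE s in lebesgue. s \<noteq> 0" "AE s in lebesgue. s \<noteq> T"
      by (auto intro!: AE_completion AE_lborel_singleton)
    ultimately have "AE s in lebesgue. s \<in> {r..T} \<longrightarrow>
        ennreal (norm (blinfun_apply (S (s - r)) (P s (\<phi> s)))) \<le> ennreal (M * K * w r * exp (l * (T - s)))"
    proof eventually_elim
      case (elim s)
      show ?case
      proof (intro impI ennreal_leI)
        assume s: "s \<in> {r..T}"
        then have "s \<in> {0<..<T}" using elim r(1) by auto
        then have Ps: "norm (P s (\<phi> s)) \<le> K * norm (\<phi> s)" using elim by blast
        have "norm (blinfun_apply (S (s - r)) (P s (\<phi> s))) \<le> norm (S (s - r)) * norm (P s (\<phi> s))"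
          by (rule norm_blinfun)
        also have "\<dots> \<le> M * (K * norm (\<phi> s))"
          using s r(1) M Ps by (intro mult_mono) auto
        also have "\<dots> = M * K * norm (\<phi> s)" by simp
        also have "\<dots> \<le> M * K * (w r * exp (l * (T - s)))"
          using \<phi>w[of s] s r(1) MK by (intro mult_left_mono) auto
        finally show "norm (blinfun_apply (S (s - r)) (P s (\<phi> s))) \<le> M * K * w r * exp (l * (T - s))"
          by (simp add: mult.assoc)
      qed
    qed
    then have "AE s in lebesgue_on {r..T}.
        ennreal (norm (blinfun_apply (S (s - r)) (P s (\<phi> s)))) \<le> ennreal (M * K * w r * exp (l * (T - s)))"
      by (subst AE_restrict_space_iff) auto
    then have "ennreal (norm v) \<le> (\<integral>\<^sup>+s. ennreal (M * K * w r * exp (l * (T - s))) \<partial>lebesgue_on {r..T})"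
      by (intro complete_measure.norm_bochner_integral_is_le[OF complete_measure_lebesgue_on int])
        (auto intro!: measurable_restrict_space1 measurable_completion)
    also have "\<dots> \<le> ennreal (M * K * w r / l * exp (l * (T - r)))"
      using MK w0 l r(1) by (intro nn_integral_exp_decay) auto
    finally have "norm v \<le> M * K * w r / l * exp (l * (T - r))"
      using MK w0 l by (simp add: ennreal_le_iff)
    also have "\<dots> = (M * K / l) * (w r * exp (l * (T - r)))" by simp
    also have "\<dots> \<le> 1 / 2 * (w r * exp (l * (T - r)))" using l(2) w0 by (intro mult_right_mono) auto
    finally have v: "norm v \<le> 1 / 2 * (w r * exp (l * (T - r)))" .
    have "norm (S (T - r) \<phi>T) \<le> norm (S (T - r)) * norm \<phi>T" by (rule norm_blinfun)
    also have "\<dots> \<le> M * norm \<phi>T" using r(1) by (intro mult_right_mono M(2)) auto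
    finally have "norm (\<phi> r) \<le> M * norm \<phi>T + 1 / 2 * (w r * exp (l * (T - r)))"
      using norm_triangle_ineq[of v "S (T - r) \<phi>T"] v by (simp add: v_def)
    moreover have "w r * exp (l * (T - r)) = norm (\<phi> r)" by (simp add: w_def flip: exp_add)
    ultimately have \<phi>r: "norm (\<phi> r) \<le> 2 * M * norm \<phi>T" by simp
    have "w r \<le> 1 * norm (\<phi> r)" unfolding w_def using l(1) r(1) by (intro mult_right_mono) auto
    then have "w r \<le> 2 * M * norm \<phi>T" using \<phi>r by simp
    moreover have "exp (l * (T - t)) \<le> exp (l * T)" using l(1) t by simp
    ultimately have "w r * exp (l * (T - t)) \<le> (2 * M * norm \<phi>T) * exp (l * T)"
      using w0 M(1) by (intro mult_mono) auto
    then have "norm (\<phi> t) \<le> (2 * M * norm \<phi>T) * exp (l * T)" using \<phi>w[OF t] by linarith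
    then show ?thesis by (simp add: mult_ac)
  qed
  then show ?thesis using M(1) by (intro that[of "2 * M * exp (l * T)"]) auto
qed

section \<open>The observation in the Lebesgue norm\<close>

text \<open>
  Concavity: on the unit interval a power with exponent at most \<open>1\<close> dominates the identity.
\<close>

lemma powr_add_le:
  fixes a b r :: real
  assumes "a \<ge> 0" "b \<ge> 0" "0 \<le> r" "r \<le> 1"
  shows "(a + b) powr r \<le> a powr r + b powr r"
proof (cases "a + b = 0")
  case False
  define s where "s = a + b"
  have s: "s > 0" using False assms(1,2) by (simp add: s_def)
  have "x / s \<le> (x / s) powr r" if "0 \<le> x" "x \<le> s" for x
    using powr_mono'[of r 1 "x / s"] that s assms(4) by simp
  then have "a / s + b / s \<le> (a / s) powr r + (b / s) powr r"
    using assms(1,2) by (intro add_mono) (auto simp: s_def)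
  also have "a / s + b / s = 1" using s by (simp add: s_def flip: add_divide_distrib)
  finally have "s powr r * 1 \<le> s powr r * ((a / s) powr r + (b / s) powr r)" by (intro mult_left_mono) auto
  also have "\<dots> = a powr r + b powr r"
    using assms(1,2) s by (simp add: powr_divide distrib_left)
  finally show ?thesis by (simp add: s_def)
qed (use assms in auto)

text \<open>
  The factor \<open>2\<close> replaces Minkowski's inequality and comes from the pointwise bound of
  a sum by twice the maximum. A quasi-norm is enough for the extension of estimates.
\<close>

lemma Lq_norm_add_le:
  assumes q: "q \<ge> 1"
    and f: "integrable M (\<lambda>x. norm (f x) powr q)" and g: "integrable M (\<lambda>x. norm (g x) powr q)"
  shows "Lq_norm M q (\<lambda>x. f x + g x) \<le> 2 * (Lq_norm M q f + Lq_norm M q g)"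
proof -
  let ?I = "\<integral>x. norm (f x) powr q \<partial>M" and ?J = "\<integral>x. norm (g x) powr q \<partial>M"
  have I: "?I \<ge> 0" "?J \<ge> 0" by (auto intro: integral_nonneg_AE)
  have pointwise: "norm (f x + g x) powr q \<le> 2 powr q * (norm (f x) powr q + norm (g x) powr q)" for x
  proof -
    let ?m = "max (norm (f x)) (norm (g x))"
    have "norm (f x + g x) \<le> 2 * ?m" using norm_triangle_ineq[of "f x" "g x"] by simp
    then have "norm (f x + g x) powr q \<le> (2 * ?m) powr q" using q by (intro powr_mono2) auto
    also have "\<dots> = 2 powr q * ?m powr q" by (simp add: powr_mult)
    also have "?m powr q \<le> norm (f x) powr q + norm (g x) powr q" by (simp add: max_def)
    finally show ?thesis by simp
  qed
  have "(\<integral>x. norm (f x + g x) powr q \<partial>M) \<le> (\<integral>x. 2 powr q * (norm (f x) powr q + norm (g x) powr q) \<partial>M)"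
    using f g pointwise by (intro integral_mono') auto
  also have "\<dots> = 2 powr q * (?I + ?J)" using f g by simp
  finally have "Lq_norm M q (\<lambda>x. f x + g x) \<le> (2 powr q * (?I + ?J)) powr (1 / q)"
    unfolding Lq_norm_def using q by (intro powr_mono2) (auto intro: integral_nonneg_AE)
  also have "\<dots> = 2 * (?I + ?J) powr (1 / q)" using q I by (simp add: powr_mult powr_powr)
  also have "\<dots> \<le> 2 * (?I powr (1 / q) + ?J powr (1 / q))"
    using q I by (intro mult_left_mono powr_add_le) auto
  finally show ?thesis by (simp add: Lq_norm_def)
qed

lemma norm_badj_le: "norm (badj L f) \<le> norm L * norm f"
  unfolding badj_def using norm_blinfun_compose[of f L] by (simp add: mult.commute)

lemma badj_linear: "badj L (f + g) = badj L f + badj L g" "badj L (a *\<^sub>R f) = a *\<^sub>R badj L f" "badj L 0 = 0"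
  by (auto simp: badj_def blinfun_eqI blinfun.bilinear_simps blinfun_apply_blinfun_compose)

text \<open>
  For a simple operator-valued function the observation takes the form of one of finitely many
  continuous functions on each level set; the general case is an almost everywhere limit.
\<close>

lemma borel_measurable_norm_badj:
  fixes B :: "real \<Rightarrow> 'u::banach \<Rightarrow>\<^sub>L 'y::banach"
  assumes B: "strongly_measurable (lebesgue_on {0<..<T}) B" and \<phi>: "continuous_on {0..T} \<phi>"
  shows "(\<lambda>t. norm (badj (B t) (\<phi> t))) \<in> borel_measurable (lebesgue_on {0<..<T})"
proof -
  let ?M = "lebesgue_on {0<..<T}"
  obtain s where s: "\<And>i::nat. simple_function ?M (s i)" "AE t in ?M. (\<lambda>i. s i t) \<longlonglongrightarrow> B t"
    using B unfolding strongly_measurable_def by blast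
  have \<phi>': "continuous_on {0<..<T} \<phi>" by (rule continuous_on_subset[OF \<phi>]) auto
  have "(\<lambda>t. norm (badj (s i t) (\<phi> t))) \<in> borel_measurable ?M" for i
  proof (rule measurable_compose_countable'[where I = "s i ` space ?M"])
    show "(\<lambda>t. norm (badj L (\<phi> t))) \<in> borel_measurable ?M" for L :: "'u \<Rightarrow>\<^sub>L 'y"
      unfolding badj_def
      by (intro continuous_imp_measurable_on_sets_lebesgue continuous_intros \<phi>'
          bounded_bilinear.continuous_on[OF bounded_bilinear_blinfun_compose]) auto
    have fin: "finite (s i ` space ?M)" using s(1) by (rule simple_functionD)
    then show "countable (s i ` space ?M)" by (rule countable_finite)
    show "s i \<in> measurable ?M (count_space (s i ` space ?M))"
      using s(1)[of i] fin by (subst measurable_count_space_eq2) (auto simp: simple_function_def)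
  qed
  moreover have "AE t in ?M. (\<lambda>i. norm (badj (s i t) (\<phi> t))) \<longlonglongrightarrow> norm (badj (B t) (\<phi> t))"
    using s(2)
  proof eventually_elim
    case (elim t)
    then show ?case unfolding badj_def
      by (intro tendsto_norm bounded_bilinear.tendsto[OF bounded_bilinear_blinfun_compose] tendsto_const)
  qed
  ultimately show ?thesis
    by (rule complete_measure.borel_measurable_AE_LIMSEQ[OF complete_measure_lebesgue_on, rotated 1]) simp
qed

lemma Lq_norm_badj:
  fixes B :: "real \<Rightarrow> 'u::banach \<Rightarrow>\<^sub>L 'y::banach"
  assumes B: "strongly_measurable (lebesgue_on {0<..<T}) B"
    and K: "AE t in lebesgue_on {0<..<T}. norm (B t) \<le> K" "K \<ge> 0"
    and T: "T > 0" and q: "q \<ge> 1"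
    and \<phi>: "continuous_on {0..T} \<phi>" and c: "\<And>t. t \<in> {0..T} \<Longrightarrow> norm (\<phi> t) \<le> c"
  shows "integrable (lebesgue_on {0<..<T}) (\<lambda>t. norm (badj (B t) (\<phi> t)) powr q)"
    and "Lq_norm (lebesgue_on {0<..<T}) q (\<lambda>t. badj (B t) (\<phi> t)) \<le> T powr (1 / q) * K * c"
proof -
  let ?M = "lebesgue_on {0<..<T}"
  interpret finite_measure ?M by (rule finite_measure_lebesgue_on) auto
  have c0: "c \<ge> 0" using c[of 0] T norm_ge_zero[of "\<phi> 0"] by (simp del: norm_ge_zero)
  have bound: "AE t in ?M. norm (badj (B t) (\<phi> t)) powr q \<le> (K * c) powr q"
    using K(1) AE_space
  proof eventually_elim
    case (elim t)
    have "norm (badj (B t) (\<phi> t)) \<le> norm (B t) * norm (\<phi> t)" by (rule norm_badj_le)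
    also have "\<dots> \<le> K * c" using elim K(2) by (intro mult_mono c) auto
    finally show ?case using q by (intro powr_mono2) auto
  qed
  show int: "integrable ?M (\<lambda>t. norm (badj (B t) (\<phi> t)) powr q)"
  proof (rule integrable_const_bound)
    show "AE t in ?M. norm (norm (badj (B t) (\<phi> t)) powr q) \<le> (K * c) powr q" using bound by simp
    show "(\<lambda>t. norm (badj (B t) (\<phi> t)) powr q) \<in> borel_measurable ?M"
      using borel_measurable_norm_badj[OF B \<phi>] by measurable
  qed
  have "(\<integral>t. norm (badj (B t) (\<phi> t)) powr q \<partial>?M) \<le> (\<integral>t. (K * c) powr q \<partial>?M)"
    using bound int by (intro integral_mono_AE) auto
  also have "\<dots> = T * (K * c) powr q" using T by (simp add: measure_restrict_space)
  finally have "Lq_norm ?M q (\<lambda>t. badj (B t) (\<phi> t)) \<le> (T * (K * c) powr q) powr (1 / q)"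
    unfolding Lq_norm_def using q by (intro powr_mono2) (auto intro: integral_nonneg_AE)
  also have "\<dots> = T powr (1 / q) * K * c" using T q K(2) c0 by (simp add: powr_mult powr_powr)
  finally show "Lq_norm ?M q (\<lambda>t. badj (B t) (\<phi> t)) \<le> T powr (1 / q) * K * c" .
qed

lemma conj_exponent_ge_1:
  assumes "1 < p"
  shows "conj_exponent p \<ge> 1"
proof (cases p)
  case (real r)
  then show ?thesis using assms by (simp add: conj_exponent_def field_simps)
qed (use assms in \<open>auto simp: conj_exponent_def\<close>)

section \<open>The observability estimates\<close>

text \<open>
  The abstract extension lemma is applied to the space \<open>E\<close> of final data that admit a mild solution,
  with the norm of the observation as quasi-seminorm. Solutions are unique by the Gronwall bound, so
  the observation is a function of the final datum, and the same bound shows it to be continuous.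
\<close>

lemma observability_modulo_functionals:
  fixes T q :: real and S :: "real \<Rightarrow> 'y::banach dual \<Rightarrow>\<^sub>L 'y dual"
    and F :: "real \<Rightarrow> ('y \<Rightarrow>\<^sub>L 'y)" and B :: "real \<Rightarrow> ('u::banach \<Rightarrow>\<^sub>L 'y)"
  defines "mild \<equiv> mild_solution_for S T (\<lambda>t. badj (F t))"
    and "N \<equiv> \<lambda>\<phi>. Lq_norm (lebesgue_on {0<..<T}) q (\<lambda>t. badj (B t) (\<phi> t))"
  assumes S: "C0_semigroup S" and T: "T > 0" and q: "q \<ge> 1"
    and F: "L_infinity (lebesgue_on {0<..<T}) F"
    and B: "L_infinity (lebesgue_on {0<..<T}) B"
    and Y: "finite_codimensional Y" and C: "C > 0"
    and est: "\<And>\<phi>T \<phi>. \<phi>T \<in> Y \<Longrightarrow> mild \<phi>T \<phi> \<Longrightarrow> norm \<phi>T \<le> C * N \<phi>"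
  shows "\<exists>\<Phi> C'. finite \<Phi> \<and> C' > 0 \<and>
    (\<forall>\<phi>T \<phi>. mild \<phi>T \<phi> \<longrightarrow> norm \<phi>T \<le> C' * (N \<phi> + (\<Sum>l\<in>\<Phi>. \<bar>blinfun_apply l \<phi>T\<bar>)))"
proof -
  let ?M = "lebesgue_on {0<..<T}"
  obtain KF where "AE t in ?M. norm (F t) \<le> KF" using F unfolding L_infinity_def by blast
  then have KF: "AE t in ?M. \<forall>x. norm (badj (F t) x) \<le> max KF 0 * norm x"
    by eventually_elim (auto intro!: order_trans[OF norm_badj_le] mult_right_mono)
  obtain KB where "AE t in ?M. norm (B t) \<le> KB" using B unfolding L_infinity_def by blast
  then have KB: "AE t in ?M. norm (B t) \<le> max KB 0" by eventually_elim simp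
  have Bm: "strongly_measurable ?M B" using B unfolding L_infinity_def by simp
  obtain M where M: "M \<ge> 0" "\<And>x \<phi> t. mild x \<phi> \<Longrightarrow> t \<in> {0..T} \<Longrightarrow> norm (\<phi> t) \<le> M * norm x"
    using mild_solution_for_bound[OF S T _ KF] unfolding mild_def by (metis max.cobounded2)
  have cont: "continuous_on {0..T} \<phi>" if "mild x \<phi>" for x \<phi>
    using that unfolding mild_def mild_solution_for_def by simp
  note badj = Lq_norm_badj[OF Bm KB _ T q cont M(2)]
  have mild_add: "mild (x + y) (\<lambda>t. \<phi> t + \<psi> t)" if "mild x \<phi>" "mild y \<psi>" for x y \<phi> \<psi>
    using that unfolding mild_def by (intro mild_solution_for_add badj_linear)
  have mild_scale: "mild (a *\<^sub>R x) (\<lambda>t. a *\<^sub>R \<phi> t)" if "mild x \<phi>" for a x \<phi>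
    using that unfolding mild_def by (intro mild_solution_for_scaleR badj_linear)
  have mild_0: "mild 0 (\<lambda>t. 0)"
    unfolding mild_def by (intro mild_solution_for_zero badj_linear)
  define E where "E = {x. \<exists>\<phi>. mild x \<phi>}"
  define sol where "sol x = (SOME \<phi>. mild x \<phi>)" for x
  define n where "n x = N (sol x)" for x
  have sol: "mild x (sol x)" if "x \<in> E" for x
    using that unfolding E_def sol_def by (simp add: someI_ex)
  have unique: "N \<phi> = N \<psi>" if "mild x \<phi>" "mild x \<psi>" for x \<phi> \<psi>
  proof -
    have "mild (x + (- 1) *\<^sub>R x) (\<lambda>t. \<phi> t + (- 1) *\<^sub>R \<psi> t)"
      using that by (intro mild_add mild_scale)
    then have "\<phi> t = \<psi> t" if "t \<in> {0..T}" for t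
      using M(2)[OF _ that] by fastforce
    then show ?thesis unfolding N_def Lq_norm_def
      by (intro arg_cong2[where f = "(powr)"] Bochner_Integration.integral_cong) auto
  qed
  have n: "N \<phi> = n x" if "mild x \<phi>" for x \<phi>
    unfolding n_def using that sol[of x] by (intro unique[of x]) (auto simp: E_def)
  have E: "subspace E"
    unfolding subspace_def E_def using mild_0 mild_add mild_scale by blast
  have "\<exists>\<Phi> C'. finite \<Phi> \<and> C' > 0 \<and>
      (\<forall>x\<in>E. norm x \<le> C' * (n x + (\<Sum>l\<in>\<Phi>. \<bar>blinfun_apply l x\<bar>)))"
  proof (rule estimate_modulo_finitely_many_functionals[OF E _ _ _ Y C])
    show "0 \<le> n x" for x by (simp add: n_def N_def Lq_norm_def)
    show "n x \<le> (T powr (1 / q) * max KB 0 * M) * norm x" if "x \<in> E" for x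
      using badj(2)[OF _ sol[OF that] sol[OF that]] by (simp add: n_def N_def mult.assoc)
    show "n (x + y) \<le> 2 * (n x + n y)" if "x \<in> E" "y \<in> E" for x y
    proof -
      have "n (x + y) = N (\<lambda>t. sol x t + sol y t)"
        using that by (intro n[symmetric] mild_add sol)
      also have "\<dots> \<le> 2 * (n x + n y)"
        unfolding n_def N_def badj_linear
        using badj(1)[OF _ sol[OF that(1)] sol[OF that(1)]] badj(1)[OF _ sol[OF that(2)] sol[OF that(2)]]
        by (intro Lq_norm_add_le q) auto
      finally show ?thesis .
    qed
    show "norm x \<le> C * n x" if "x \<in> E \<inter> Y" for x
      unfolding n_def using that by (intro est sol) auto
  qed
  then obtain \<Phi> C' where "finite \<Phi>" "C' > 0"
    "\<And>x. x \<in> E \<Longrightarrow> norm x \<le> C' * (n x + (\<Sum>l\<in>\<Phi>. \<bar>blinfun_apply l x\<bar>))" by blast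
  then show ?thesis using n unfolding E_def by (intro exI[of _ \<Phi>] exI[of _ C']) auto
qed

theorem theorem3p3:
  fixes T :: real
    and p :: ereal
    and D :: "'y::banach set"
    and A :: "'y \<Rightarrow> 'y"
    and F :: "real \<Rightarrow> ('y \<Rightarrow>\<^sub>L 'y)"
    and B :: "real \<Rightarrow> ('u::banach \<Rightarrow>\<^sub>L 'y)"
  assumes "T > 0"
    and "reflexive_space TYPE('y)"
    and "reflexive_space TYPE('u)"
    and "1 < p"
    and "\<exists>S. generates D A S"
    and "L_infinity (lebesgue_on {0<..<T}) F"
    and "L_infinity (lebesgue_on {0<..<T}) B"
  shows
    "(\<exists>(X :: ('x + real) set) zero add smul nrm (G :: 'y dual \<Rightarrow> 'x + real) C.
        banach_space_on X zero add smul nrm \<and>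
        compact_operator_into X add smul nrm G \<and>
        C > 0 \<and>
        (\<forall>\<phi>T \<phi>. backward_mild_solution T (adj_dom D A) (adj_op D A) (\<lambda>t. badj (F t)) \<phi>T \<phi> \<longrightarrow>
           norm \<phi>T \<le> C * (Lq_norm (lebesgue_on {0<..<T}) (conj_exponent p) (\<lambda>t. badj (B t) (\<phi> t))
                            + nrm (G \<phi>T))))
     \<longleftrightarrow>
     (\<exists>(Yt :: 'y dual set) C.
        finite_codimensional Yt \<and>
        C > 0 \<and>
        (\<forall>\<phi>T\<in>Yt. \<forall>\<phi>. backward_mild_solution T (adj_dom D A) (adj_op D A) (\<lambda>t. badj (F t)) \<phi>T \<phi> \<longrightarrow>
           norm \<phi>T \<le> C * Lq_norm (lebesgue_on {0<..<T}) (conj_exponent p) (\<lambda>t. badj (B t) (\<phi> t))))"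
proof -
  let ?DA = "adj_dom D A" and ?A = "adj_op D A" and ?P = "\<lambda>t. badj (F t)"
  let ?M = "lebesgue_on {0<..<T}" and ?q = "conj_exponent p"
  let ?N = "\<lambda>\<phi>. Lq_norm ?M ?q (\<lambda>t. badj (B t) (\<phi> t))"
  let ?mild = "backward_mild_solution T ?DA ?A ?P"
  show ?thesis
  proof (rule iffI, goal_cases)
    case 1
    then obtain X :: "('x + real) set" and zero add smul nrm and G :: "'y dual \<Rightarrow> 'x + real" and C
      where X: "banach_space_on X zero add smul nrm" and G: "compact_operator_into X add smul nrm G"
        and C: "C > 0"
        and est: "\<And>\<phi>T \<phi>. ?mild \<phi>T \<phi> \<Longrightarrow> norm \<phi>T \<le> C * (?N \<phi> + nrm (G \<phi>T))"
      by blast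
    obtain Y where Y: "finite_codimensional Y" "\<And>x. x \<in> Y \<Longrightarrow> nrm (G x) \<le> 1 / (2 * C) * norm x"
      using banach_space_on.compact_operator_small_on_finite_codimensional[OF X G, of "1 / (2 * C)"] C
      by auto
    have "norm \<phi>T \<le> 2 * C * ?N \<phi>" if "\<phi>T \<in> Y" "?mild \<phi>T \<phi>" for \<phi>T \<phi>
    proof -
      have "C * nrm (G \<phi>T) \<le> C * (1 / (2 * C) * norm \<phi>T)"
        using Y(2)[OF that(1)] C by (intro mult_left_mono) auto
      also have "\<dots> = norm \<phi>T / 2" using C by simp
      finally show ?thesis using est[OF that(2)] by (simp add: distrib_left)
    qed
    then show ?case using Y(1) C by (intro exI[of _ Y] exI[of _ "2 * C"]) auto
  next
    case 2
    then obtain Y C where Y: "finite_codimensional Y" and C: "C > 0"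
      and est: "\<And>\<phi>T \<phi>. \<phi>T \<in> Y \<Longrightarrow> ?mild \<phi>T \<phi> \<Longrightarrow> norm \<phi>T \<le> C * ?N \<phi>" by blast
    have "\<exists>\<Phi> C'. finite \<Phi> \<and> C' > 0 \<and>
        (\<forall>\<phi>T \<phi>. ?mild \<phi>T \<phi> \<longrightarrow> norm \<phi>T \<le> C' * (?N \<phi> + (\<Sum>l\<in>\<Phi>. \<bar>blinfun_apply l \<phi>T\<bar>)))"
    proof (cases "\<exists>S. generates ?DA ?A S")
      case False
      then have "\<not> ?mild \<phi>T \<phi>" for \<phi>T \<phi> unfolding backward_mild_solution_def by blast
      then show ?thesis by (intro exI[of _ "{}"] exI[of _ 1]) auto
    next
      case True
      then obtain S where S: "generates ?DA ?A S" by blast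
      then have "C0_semigroup S" unfolding generates_def by simp
      then show ?thesis
        using observability_modulo_functionals[OF _ assms(1) conj_exponent_ge_1[OF assms(4)] assms(6,7) Y C] est
        unfolding backward_mild_solution_iff[OF S] by blast
    qed
    then obtain \<Phi> C' where \<Phi>: "finite \<Phi>" and C': "C' > 0"
      and bound: "\<And>\<phi>T \<phi>. ?mild \<phi>T \<phi> \<Longrightarrow> norm \<phi>T \<le> C' * (?N \<phi> + (\<Sum>l\<in>\<Phi>. \<bar>blinfun_apply l \<phi>T\<bar>))"
      by blast
    obtain X :: "('x + real) set" and zero add smul nrm and G :: "'y dual \<Rightarrow> 'x + real"
      where X: "banach_space_on X zero add smul nrm" "compact_operator_into X add smul nrm G"
        and G: "\<And>x. nrm (G x) = (\<Sum>l\<in>\<Phi>. \<bar>blinfun_apply l x\<bar>)"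
      using ex_compact_operator_norm_sum[OF \<Phi>] by blast
    show ?case
      by (rule exI[of _ X], rule exI[of _ zero], rule exI[of _ add], rule exI[of _ smul],
          rule exI[of _ nrm], rule exI[of _ G], rule exI[of _ C'])
        (use X C' bound in \<open>simp add: G\<close>)
  qed
qed

end
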